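(* Suppose $\mathcal{K}\subset\mathbb{X}_d$ is a compact set and every domain in $\overline{\mathrm{Aff}(\mathbb{C}^d)\cdot\mathcal{K}}\cap\mathbb{X}_d$ has simple boundary. Then for any $R>0$ there exist $C>0$ and $m\ge1$ such that $$\delta_\Omega(z;v)\le C\,\delta_\Omega(z)^{1/m}$$ for all $\Omega\in\mathcal{K}$, all $z\in\Omega$ with $\|z\|<R$, and all non-zero $v\in\mathbb{C}^d$.
   Context: A convex domain in $\mathbb{C}^d$ is $\mathbb{C}$-properly convex if it contains no entire complex affine line. $\mathbb{X}_d$ is the set of all non-empty $\mathbb{C}$-properly convex domains in $\mathbb{C}^d$, with the local Hausdorff topology: $\Omega_n\to\Omega$ in $\mathbb{X}_d$ if there is $R_0\ge0$ such that for all $R\ge R_0$ the Hausdorff distance between $\overline{\Omega}_n\cap\overline{B(0;R)}$ and $\overline{\Omega}\cap\overline{B(0;R)}$ tends to $0$, where $B(0;R)$ is the Euclidean ball (the Hausdorff distance between the empty set and a non-empty set is $\infty$). $\mathrm{Aff}(\mathbb{C}^d)$ is the group of complex affine automorphisms of $\mathbb{C}^d$, acting on $\mathbb{X}_d$; $\overline{\mathrm{Aff}(\mathbb{C}^d)\cdot\mathcal{K}}\cap\mathbb{X}_d$ is the set of all $\mathcal{D}\in\mathbb{X}_d$ that are limits in $\mathbb{X}_d$ of sequences $A_n\Omega_n$ with $A_n\in\mathrm{Aff}(\mathbb{C}^d)$, $\Omega_n\in\mathcal{K}$. A domain has simple boundary if every holomorphic map from the unit disk $\mathbb{D}\subset\mathbb{C}$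 into its boundary is constant. For $z\in\Omega$ and $v\in\mathbb{C}^d\setminus\{0\}$: $\delta_\Omega(z)=\inf\{\|z-w\|:w\in\partial\Omega\}$ and $\delta_\Omega(z;v)=\inf\{\|z-w\|:w\in\partial\Omega\cap(z+\mathbb{C}\cdot v)\}$. *)

theory Defs
  imports "HOL-Analysis.Analysis"
begin

definition complex_line :: "complex ^ 'd \<Rightarrow> complex ^ 'd \<Rightarrow> (complex ^ 'd) set" where
  "complex_line z v = range (\<lambda>c. z + c *s v)"

definition C_properly_convex_domains :: "(complex ^ 'd) set set" where
  "C_properly_convex_domains =
     {\<Omega>. \<Omega> \<noteq> {} \<and> open \<Omega> \<and> convex \<Omega> \<and> (\<forall>z v. v \<noteq> 0 \<longrightarrow> \<not> complex_line z v \<subseteq> \<Omega>)}"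

text \<open>In \<^typ>\<open>ennreal\<close> an infimum over the empty set is \<open>\<infinity>\<close> and a supremum over the empty
  set is \<open>0\<close>, so the distance between the empty set and a non-empty set is \<open>\<infinity>\<close>, and the
  distance from the empty set to itself is \<open>0\<close>.\<close>

definition Hausdorff_dist :: "'a::metric_space set \<Rightarrow> 'a set \<Rightarrow> ennreal" where
  "Hausdorff_dist A B =
     max (SUP a\<in>A. INF b\<in>B. ennreal (dist a b)) (SUP b\<in>B. INF a\<in>A. ennreal (dist a b))"

definition local_Hausdorff_converges ::
    "(nat \<Rightarrow> (complex ^ 'd) set) \<Rightarrow> (complex ^ 'd) set \<Rightarrow> bool" where
  "local_Hausdorff_converges \<Omega>s \<Omega> \<longleftrightarrow>
     (\<exists>R0\<ge>0. \<forall>R\<ge>R0.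
        (\<lambda>n. Hausdorff_dist (closure (\<Omega>s n) \<inter> cball 0 R) (closure \<Omega> \<inter> cball 0 R))
          \<longlonglongrightarrow> 0)"

text \<open>The local Hausdorff topology is given by its convergent sequences; as a topology it is the
  one whose open sets are the sequentially open ones.\<close>

definition local_Hausdorff_topology :: "(complex ^ 'd) set topology" where
  "local_Hausdorff_topology = topology (\<lambda>U.
     U \<subseteq> C_properly_convex_domains \<and>
     (\<forall>\<Omega>s \<Omega>. range \<Omega>s \<subseteq> C_properly_convex_domains \<and> \<Omega> \<in> U \<and> local_Hausdorff_converges \<Omega>s \<Omega>
        \<longrightarrow> (\<forall>\<^sub>F n in sequentially. \<Omega>s n \<in> U)))"

lemma openin_local_Hausdorff_topology:
  fixes U :: "(complex ^ 'd) set set"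
  shows
  "openin local_Hausdorff_topology U \<longleftrightarrow>
     U \<subseteq> C_properly_convex_domains \<and>
     (\<forall>\<Omega>s \<Omega>. range \<Omega>s \<subseteq> C_properly_convex_domains \<and> \<Omega> \<in> U \<and> local_Hausdorff_converges \<Omega>s \<Omega>
        \<longrightarrow> (\<forall>\<^sub>F n in sequentially. \<Omega>s n \<in> U))"
proof -
  let ?X = "C_properly_convex_domains :: (complex ^ 'd) set set"
  define P where "P = (\<lambda>U. U \<subseteq> ?X \<and>
     (\<forall>\<Omega>s \<Omega>. range \<Omega>s \<subseteq> ?X \<and> \<Omega> \<in> U \<and> local_Hausdorff_converges \<Omega>s \<Omega>
        \<longrightarrow> (\<forall>\<^sub>F n in sequentially. \<Omega>s n \<in> U)))"
  have "istopology P"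
    unfolding istopology_def
  proof (intro conjI allI impI)
    fix S T assume S: "P S" and T: "P T"
    then show "P (S \<inter> T)"
      unfolding P_def Int_iff eventually_conj_iff by blast
  next
    fix \<K> assume \<K>: "\<forall>K\<in>\<K>. P K"
    show "P (\<Union>\<K>)"
      unfolding P_def
    proof (intro conjI allI impI)
      show "\<Union>\<K> \<subseteq> ?X" using \<K> unfolding P_def by blast
    next
      fix \<Omega>s \<Omega>
      assume *: "range \<Omega>s \<subseteq> ?X \<and> \<Omega> \<in> \<Union>\<K> \<and> local_Hausdorff_converges \<Omega>s \<Omega>"
      then obtain K where K: "K \<in> \<K>" "\<Omega> \<in> K" by blast
      then have "\<forall>\<^sub>F n in sequentially. \<Omega>s n \<in> K"
        using \<K> * unfolding P_def by blast
      then show "\<forall>\<^sub>F n in sequentially. \<Omega>s n \<in> \<Union>\<K>"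
        by (rule eventually_mono) (use K in blast)
    qed
  qed
  then have "openin (topology P) U \<longleftrightarrow> P U"
    by (simp add: topology_inverse')
  then show ?thesis
    unfolding local_Hausdorff_topology_def P_def .
qed

lemma topspace_local_Hausdorff_topology:
  "topspace local_Hausdorff_topology = (C_properly_convex_domains :: (complex ^ 'd) set set)"
proof
  show "topspace local_Hausdorff_topology \<subseteq> (C_properly_convex_domains :: (complex ^ 'd) set set)"
    using openin_topspace openin_local_Hausdorff_topology by blast
  have "openin local_Hausdorff_topology (C_properly_convex_domains :: (complex ^ 'd) set set)"
    unfolding openin_local_Hausdorff_topology by (auto intro!: always_eventually)
  then show "C_properly_convex_domains \<subseteq> topspace (local_Hausdorff_topology :: (complex ^ 'd) set topology)"
    by (rule openin_subset)
qed

definition complex_affine_group :: "(complex ^ 'd \<Rightarrow> complex ^ 'd) set" where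
  "complex_affine_group = {\<lambda>z. A *v z + b | A b. invertible A}"

definition affine_orbit_closure :: "(complex ^ 'd) set set \<Rightarrow> (complex ^ 'd) set set" where
  "affine_orbit_closure \<K> =
     {D \<in> C_properly_convex_domains.
        \<exists>A \<Omega>s. (\<forall>n. A n \<in> complex_affine_group) \<and> (\<forall>n. \<Omega>s n \<in> \<K>) \<and>
          local_Hausdorff_converges (\<lambda>n. A n ` \<Omega>s n) D}"

definition simple_boundary :: "(complex ^ 'd) set \<Rightarrow> bool" where
  "simple_boundary \<Omega> \<longleftrightarrow>
     (\<forall>f. (\<forall>i. (\<lambda>\<zeta>. f \<zeta> $ i) holomorphic_on ball 0 1) \<and> f ` ball 0 1 \<subseteq> frontier \<Omega>
        \<longrightarrow> f constant_on ball 0 1)"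

text \<open>The infima below are infima of real numbers. They are over non-empty sets whenever \<open>\<Omega>\<close> is a
  non-empty \<open>\<complex>\<close>-properly convex domain, \<open>z \<in> \<Omega>\<close> and \<open>v \<noteq> 0\<close>.\<close>

definition boundary_dist :: "(complex ^ 'd) set \<Rightarrow> complex ^ 'd \<Rightarrow> real" where
  "boundary_dist \<Omega> z = (INF w\<in>frontier \<Omega>. norm (z - w))"

definition directional_boundary_dist ::
    "(complex ^ 'd) set \<Rightarrow> complex ^ 'd \<Rightarrow> complex ^ 'd \<Rightarrow> real" where
  "directional_boundary_dist \<Omega> z v = (INF w\<in>frontier \<Omega> \<inter> complex_line z v. norm (z - w))"

end

theory Submission
  imports Defs "HOL-Complex_Analysis.Great_Picard"
begin

text \<open>
  Fix interior balls \<open>ball x r \<subseteq> \<Omega>\<close>, uniform over the compact family, and for \<open>z \<in> \<Omega>\<close> move along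
  \<open>w s = z + s (x - z)\<close>. There is \<open>N\<close> such that passing from \<open>w s\<close> to \<open>w (N s)\<close>, for \<open>s\<close> at least the
  boundary distance of \<open>z\<close>, doubles the size of every complex disc in \<open>\<Omega>\<close> with given direction; as
  discs have bounded size, iterating gives the estimate with \<open>m = log 2 N\<close>. If no such \<open>N\<close> existed,
  affine maps normalizing the domains at \<open>w (N s)\<close> would produce, as \<open>N \<rightarrow> \<infinity>\<close>, a limit domain with a
  boundary point that is the centre of a non-trivial affine disc in the closure. By convexity this
  disc lies in the boundary, contradicting simplicity.

  The normalizing maps send an almost maximal (in determinant) system of discs at a point to the
  coordinate discs. The normalized domains contain a fixed ball and no large disc at the origin, so
  their gauges are equi-Lipschitz and Arzela--Ascoli yields limits without complex lines.
\<close>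

section \<open>Local Hausdorff convergence\<close>

lemma Hausdorff_dist_lessD:
  assumes "Hausdorff_dist A B < ennreal e"
  shows "a \<in> A \<Longrightarrow> \<exists>b\<in>B. dist a b < e" and "b \<in> B \<Longrightarrow> \<exists>a\<in>A. dist a b < e"
proof -
  have less: "(SUP a\<in>A. INF b\<in>B. ennreal (dist a b)) < ennreal e"
    "(SUP b\<in>B. INF a\<in>A. ennreal (dist a b)) < ennreal e"
    using assms by (auto simp: Hausdorff_dist_def)
  show "\<exists>b\<in>B. dist a b < e" if "a \<in> A"
  proof -
    have "(INF b\<in>B. ennreal (dist a b)) < ennreal e"
      using less(1) that by (meson SUP_upper le_less_trans)
    then show ?thesis
      by (auto simp: INF_less_iff ennreal_less_iff)
  qed
  show "\<exists>a\<in>A. dist a b < e" if "b \<in> B"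
  proof -
    have "(INF a\<in>A. ennreal (dist a b)) < ennreal e"
      using less(2) that by (meson SUP_upper le_less_trans)
    then show ?thesis
      by (auto simp: INF_less_iff ennreal_less_iff)
  qed
qed

lemma Hausdorff_dist_le:
  assumes "\<And>a. a \<in> A \<Longrightarrow> \<exists>b\<in>B. dist a b \<le> e" and "\<And>b. b \<in> B \<Longrightarrow> \<exists>a\<in>A. dist a b \<le> e"
  shows "Hausdorff_dist A B \<le> ennreal e"
  unfolding Hausdorff_dist_def
proof (intro max.boundedI SUP_least)
  fix a assume "a \<in> A"
  then obtain b where "b \<in> B" "dist a b \<le> e" using assms(1) by blast
  then show "(INF b\<in>B. ennreal (dist a b)) \<le> ennreal e"
    by (meson INF_lower2 ennreal_leI)
next
  fix b assume "b \<in> B"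
  then obtain a where "a \<in> A" "dist a b \<le> e" using assms(2) by blast
  then show "(INF a\<in>A. ennreal (dist a b)) \<le> ennreal e"
    by (meson INF_lower2 ennreal_leI)
qed

lemma tendsto_ennreal_zeroI:
  assumes "\<And>e. e > 0 \<Longrightarrow> \<forall>\<^sub>F n in F. f n \<le> ennreal e"
  shows "(f \<longlongrightarrow> 0) F"
proof (rule order_tendstoI)
  fix a :: ennreal assume "0 < a"
  then obtain b where b: "0 < b" "b < a" using dense by blast
  define e where "e = enn2real b"
  have "ennreal e = b" using b by (auto simp: e_def intro!: ennreal_enn2real order.strict_trans2[OF b(2)])
  moreover from this have "0 < e" using b by (metis ennreal_less_zero_iff)
  ultimately have "0 < e" "ennreal e < a" using b by auto
  then show "\<forall>\<^sub>F n in F. f n < a"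
    using assms[of e] by (auto elim!: eventually_mono)
qed auto

lemma local_Hausdorff_convergesE:
  assumes "local_Hausdorff_converges \<Omega>s \<Omega>"
  obtains R0 where "R0 \<ge> 0"
    "\<And>R e. R \<ge> R0 \<Longrightarrow> e > 0 \<Longrightarrow>
      \<forall>\<^sub>F n in sequentially.
        (\<forall>a \<in> closure (\<Omega>s n) \<inter> cball 0 R. \<exists>b \<in> closure \<Omega> \<inter> cball 0 R. dist a b < e) \<and>
        (\<forall>b \<in> closure \<Omega> \<inter> cball 0 R. \<exists>a \<in> closure (\<Omega>s n) \<inter> cball 0 R. dist a b < e)"
proof -
  obtain R0 where R0: "R0 \<ge> 0" "\<And>R. R \<ge> R0 \<Longrightarrow>
      (\<lambda>n. Hausdorff_dist (closure (\<Omega>s n) \<inter> cball 0 R) (closure \<Omega> \<inter> cball 0 R)) \<longlonglongrightarrow> 0"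
    using assms unfolding local_Hausdorff_converges_def by blast
  show ?thesis
  proof (rule that[OF R0(1)])
    fix R e :: real assume "R \<ge> R0" "e > 0"
    then have "\<forall>\<^sub>F n in sequentially.
        Hausdorff_dist (closure (\<Omega>s n) \<inter> cball 0 R) (closure \<Omega> \<inter> cball 0 R) < ennreal e"
      using R0(2)[OF \<open>R \<ge> R0\<close>] by (auto dest: order_tendstoD(2)[where a = "ennreal e"])
    then show "\<forall>\<^sub>F n in sequentially.
        (\<forall>a \<in> closure (\<Omega>s n) \<inter> cball 0 R. \<exists>b \<in> closure \<Omega> \<inter> cball 0 R. dist a b < e) \<and>
        (\<forall>b \<in> closure \<Omega> \<inter> cball 0 R. \<exists>a \<in> closure (\<Omega>s n) \<inter> cball 0 R. dist a b < e)"
    proof (rule eventually_mono)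
      fix n assume *: "Hausdorff_dist (closure (\<Omega>s n) \<inter> cball 0 R) (closure \<Omega> \<inter> cball 0 R) < ennreal e"
      show "(\<forall>a \<in> closure (\<Omega>s n) \<inter> cball 0 R. \<exists>b \<in> closure \<Omega> \<inter> cball 0 R. dist a b < e) \<and>
        (\<forall>b \<in> closure \<Omega> \<inter> cball 0 R. \<exists>a \<in> closure (\<Omega>s n) \<inter> cball 0 R. dist a b < e)"
        using Hausdorff_dist_lessD[OF *] by blast
    qed
  qed
qed

lemma local_Hausdorff_converges_const:
  fixes \<Omega> :: "(complex ^ 'd) set"
  shows "local_Hausdorff_converges (\<lambda>n. \<Omega>) \<Omega>"
proof -
  have "Hausdorff_dist A A = 0" for A :: "(complex ^ 'd) set"
    using Hausdorff_dist_le[of A A 0] by force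
  then show ?thesis
    by (auto simp: local_Hausdorff_converges_def intro!: exI[of _ 0])
qed

lemma local_Hausdorff_converges_subseq:
  assumes "local_Hausdorff_converges \<Omega>s \<Omega>" "strict_mono k"
  shows "local_Hausdorff_converges (\<Omega>s \<circ> k) \<Omega>"
proof -
  obtain R0 where R0: "R0 \<ge> 0" "\<And>R. R \<ge> R0 \<Longrightarrow>
      (\<lambda>n. Hausdorff_dist (closure (\<Omega>s n) \<inter> cball 0 R) (closure \<Omega> \<inter> cball 0 R)) \<longlonglongrightarrow> 0"
    using assms unfolding local_Hausdorff_converges_def by blast
  then show ?thesis
    using LIMSEQ_subseq_LIMSEQ[OF R0(2) assms(2)]
    unfolding local_Hausdorff_converges_def o_def by blast
qed

text \<open>A convergent sequence \<open>x\<close> is bounded, so its members lie in one ball on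
  which the truncated closures are eventually close. Points of \<open>closure \<Omega>\<close> close
  to \<open>x n\<close> then approach \<open>l\<close>.\<close>

lemma local_Hausdorff_limit_in_closure:
  assumes "local_Hausdorff_converges \<Omega>s \<Omega>" "\<forall>\<^sub>F n in sequentially. x n \<in> closure (\<Omega>s n)"
    and "x \<longlonglongrightarrow> l"
  shows "l \<in> closure \<Omega>"
proof -
  obtain R0 where R0: "R0 \<ge> 0"
    "\<And>R e. R \<ge> R0 \<Longrightarrow> e > 0 \<Longrightarrow>
      \<forall>\<^sub>F n in sequentially.
        (\<forall>a \<in> closure (\<Omega>s n) \<inter> cball 0 R. \<exists>b \<in> closure \<Omega> \<inter> cball 0 R. dist a b < e) \<and>
        (\<forall>b \<in> closure \<Omega> \<inter> cball 0 R. \<exists>a \<in> closure (\<Omega>s n) \<inter> cball 0 R. dist a b < e)"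
    by (rule local_Hausdorff_convergesE[OF assms(1)]) blast
  obtain M where M: "\<And>n. norm (x n) \<le> M"
    using convergent_imp_bounded[OF assms(3)] by (auto simp: bounded_iff)
  define R where "R = max R0 M"
  have "norm (x n) \<le> R" for n
    using M[of n] by (simp add: R_def)
  then have xR: "\<forall>\<^sub>F n in sequentially. x n \<in> closure (\<Omega>s n) \<inter> cball 0 R"
    using assms(2) by simp
  have "\<exists>y\<in>closure \<Omega>. dist y l < e" if "e > 0" for e
  proof -
    have "\<forall>\<^sub>F n in sequentially. dist (x n) l < e/2"
      using tendstoD[OF assms(3), of "e/2"] that by simp
    moreover have "R \<ge> R0" "e / 2 > 0" using that by (auto simp: R_def)
    from R0(2)[OF this] xR have "\<forall>\<^sub>F n in sequentially. \<exists>b \<in> closure \<Omega>. dist (x n) b < e/2"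
      by eventually_elim blast
    ultimately have "\<forall>\<^sub>F n in sequentially. dist (x n) l < e/2 \<and> (\<exists>b \<in> closure \<Omega>. dist (x n) b < e/2)"
      by (rule eventually_conj)
    then obtain n b where "dist (x n) l < e/2" "b \<in> closure \<Omega>" "dist (x n) b < e/2"
      using eventually_happens'[OF sequentially_bot] by blast
    then show ?thesis
      by (metis dist_triangle_half_r)
  qed
  then show ?thesis
    by (metis closed_closure closed_approachable)
qed

text \<open>Convexity upgrades Hausdorff closeness to inclusion: a point near \<open>x\<close>
  missing from \<open>closure (\<Omega>s n)\<close> is cut off by a hyperplane, and moving it a
  further \<open>r\<close> away from that hyperplane gives a point of the limit domain too far from
  \<open>closure (\<Omega>s n)\<close>.\<close>

lemma local_Hausdorff_eventually_ball_subset: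
  assumes "local_Hausdorff_converges \<Omega>s \<Omega>" "\<And>n. open (\<Omega>s n)" "\<And>n. convex (\<Omega>s n)"
    and "open \<Omega>" "x \<in> \<Omega>"
  obtains r where "r > 0" "\<forall>\<^sub>F n in sequentially. ball x r \<subseteq> \<Omega>s n"
proof -
  obtain R0 where R0: "R0 \<ge> 0"
    "\<And>R e. R \<ge> R0 \<Longrightarrow> e > 0 \<Longrightarrow>
      \<forall>\<^sub>F n in sequentially.
        (\<forall>a \<in> closure (\<Omega>s n) \<inter> cball 0 R. \<exists>b \<in> closure \<Omega> \<inter> cball 0 R. dist a b < e) \<and>
        (\<forall>b \<in> closure \<Omega> \<inter> cball 0 R. \<exists>a \<in> closure (\<Omega>s n) \<inter> cball 0 R. dist a b < e)"
    by (rule local_Hausdorff_convergesE[OF assms(1)]) blast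
  obtain r' where r': "r' > 0" "cball x r' \<subseteq> \<Omega>"
    using assms(4,5) open_contains_cball by blast
  \<comment> \<open>Half of the radius keeps points of \<open>ball x r\<close> inside
    \<open>cball x r'\<close> after a displacement of length \<open>r\<close>.\<close>
  define r where "r = r'/2"
  define R where "R = max R0 (norm x + r')"
  have "r > 0" using r' by (simp add: r_def)
  moreover have "\<forall>\<^sub>F n in sequentially. ball x r \<subseteq> \<Omega>s n"
    using R0(2)[of R r, OF _ \<open>r > 0\<close>, unfolded R_def, OF max.cobounded1]
  proof (rule eventually_mono)
    fix n assume "(\<forall>a \<in> closure (\<Omega>s n) \<inter> cball 0 (max R0 (norm x + r')). \<exists>b \<in> closure \<Omega> \<inter> cball 0 (max R0 (norm x + r')). dist a b < r) \<and>
        (\<forall>b \<in> closure \<Omega> \<inter> cball 0 (max R0 (norm x + r')). \<exists>a \<in> closure (\<Omega>s n) \<inter> cball 0 (max R0 (norm x + r')). dist a b < r)"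
    then have near: "\<And>b. b \<in> closure \<Omega> \<Longrightarrow> norm b \<le> norm x + r' \<Longrightarrow> \<exists>a \<in> closure (\<Omega>s n). dist a b < r"
      by fastforce
    have "y \<in> closure (\<Omega>s n)" if y: "y \<in> ball x r" for y
    proof (rule ccontr)
      assume "y \<notin> closure (\<Omega>s n)"
      then obtain a b where ab: "inner a y < b" "\<And>w. w \<in> closure (\<Omega>s n) \<Longrightarrow> inner a w > b"
        using separating_hyperplane_closed_point[of "closure (\<Omega>s n)" y] assms(3) convex_closure by auto
      \<comment> \<open>Pushing \<open>y\<close> by \<open>r\<close> away from the separating half-space stays in the limit domain.\<close>
      define q where "q = y - r *\<^sub>R sgn a"
      have "norm (r *\<^sub>R sgn a) \<le> r"
        using \<open>r > 0\<close> by (simp add: norm_sgn)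
      then have "dist x q \<le> r'"
        using y norm_triangle_ineq[of "x - y" "r *\<^sub>R sgn a"] by (simp add: q_def dist_norm r_def algebra_simps)
      moreover from this have "norm q \<le> norm x + r'"
        using norm_triangle_ineq2[of q x] by (simp add: dist_norm norm_minus_commute)
      ultimately obtain w where w: "w \<in> closure (\<Omega>s n)" "dist w q < r"
        using near[of q] r' closure_subset by (metis mem_cball subsetD)
      have "a \<noteq> 0" using ab(1) ab(2)[OF w(1)] by auto
      have "inner a (w - q) \<le> norm a * norm (w - q)"
        by (rule norm_cauchy_schwarz)
      also have "\<dots> < norm a * r"
        using w(2) \<open>a \<noteq> 0\<close> by (simp add: dist_norm)
      finally have "inner a w - inner a q < norm a * r"
        by (simp add: inner_diff_right)
      moreover have "inner a (sgn a) = norm a"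
        using \<open>a \<noteq> 0\<close> by (simp add: sgn_div_norm power2_norm_eq_inner[symmetric] power2_eq_square)
      then have "inner a q = inner a y - r * norm a"
        by (simp add: q_def inner_diff_right)
      ultimately show False
        using ab(1) ab(2)[OF w(1)] by (simp add: algebra_simps)
    qed
    \<comment> \<open>An open convex set equals the interior of its closure, so the inclusion in the
      closure is enough.\<close>
    then have "ball x r \<subseteq> interior (closure (\<Omega>s n))"
      by (intro interior_maximal) auto
    then show "ball x r \<subseteq> \<Omega>s n"
      using convex_interior_closure[OF assms(3)[of n]] interior_open[OF assms(2)[of n]] by simp
  qed
  ultimately show thesis by (rule that)
qed

text \<open>An open convex set is the interior of its closure. Limits of points of \<open>E\<close>
  lie in \<open>closure D\<close>, and interior balls of \<open>D\<close> persist in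
  \<open>E\<close>, giving the two inclusions.\<close>

lemma local_Hausdorff_const_unique:
  assumes "local_Hausdorff_converges (\<lambda>n. E) D" "open E" "convex E" "open D" "convex D"
  shows "E = D"
proof -
  have "closure E \<subseteq> closure D"
    using local_Hausdorff_limit_in_closure[OF assms(1), of "\<lambda>_. x" x for x] by auto
  then have "E \<subseteq> D"
    by (metis assms convex_interior_closure interior_mono interior_open)
  moreover have "D \<subseteq> E"
  proof
    fix x assume "x \<in> D"
    then obtain r where "r > 0" "\<forall>\<^sub>F n in sequentially. ball x r \<subseteq> E"
      using local_Hausdorff_eventually_ball_subset[OF assms(1) assms(2,3,4)] by blast
    then show "x \<in> E" by auto
  qed
  ultimately show ?thesis by blast
qed

text \<open>The topology is defined by sequences, without a metric, so a covering argument is used.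
  If no subsequence converged, the complements of the tails \<open>T N\<close> would be open and
  cover \<open>\<K>\<close>, but a finite subcover misses a late term of the sequence.\<close>

lemma compactin_local_Hausdorff_convergent_subseq:
  fixes \<K> :: "(complex ^ 'd) set set"
  assumes "compactin local_Hausdorff_topology \<K>" "\<And>n. \<Omega>s n \<in> \<K>"
  obtains k \<Omega> where "strict_mono (k :: nat \<Rightarrow> nat)" "\<Omega> \<in> C_properly_convex_domains"
    "local_Hausdorff_converges (\<Omega>s \<circ> k) \<Omega>"
proof -
  let ?X = "C_properly_convex_domains :: (complex ^ 'd) set set"
  have KX: "\<K> \<subseteq> ?X"
    using compactin_subset_topspace[OF assms(1)] by (simp add: topspace_local_Hausdorff_topology)
  have False if no: "\<And>k \<Omega>. strict_mono (k :: nat \<Rightarrow> nat) \<Longrightarrow> \<Omega> \<in> ?X \<Longrightarrow>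
      \<not> local_Hausdorff_converges (\<Omega>s \<circ> k) \<Omega>"
  proof -
    \<comment> \<open>A domain occurring infinitely often would give a constant, hence convergent,
      subsequence.\<close>
    have repeat: "\<exists>N. \<forall>n\<ge>N. \<Omega>s n \<noteq> E" if "E \<in> ?X" for E
    proof (rule ccontr)
      assume "\<nexists>N. \<forall>n\<ge>N. \<Omega>s n \<noteq> E"
      then have "infinite {n. \<Omega>s n = E}"
        by (auto simp: infinite_nat_iff_unbounded_le)
      then have mono: "strict_mono (enumerate {n. \<Omega>s n = E})"
        and "\<Omega>s (enumerate {n. \<Omega>s n = E} n) = E" for n
        using enumerate_in_set by (auto simp: strict_mono_enumerate)
      then have "\<Omega>s \<circ> enumerate {n. \<Omega>s n = E} = (\<lambda>n. E)"
        by auto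
      then show False
        using no[OF mono that] local_Hausdorff_converges_const[of E] by simp
    qed
    define T where "T N = \<Omega>s ` {N..}" for N
    \<comment> \<open>If a sequence \<open>Ds\<close> with limit \<open>D\<close> outside the tail
      met the tail infinitely often, a subsequence would consist of terms
      \<open>\<Omega>s (m i)\<close>. When the indices \<open>m i\<close> take finitely many values,
      one recurs and \<open>D\<close> equals a tail term; otherwise a subsequence of
      \<open>\<Omega>s\<close> converges to \<open>D\<close>.\<close>
    have op: "openin local_Hausdorff_topology (?X - T N)" for N
      unfolding openin_local_Hausdorff_topology
    proof (intro conjI allI impI)
      fix Ds D assume D: "range Ds \<subseteq> ?X \<and> D \<in> ?X - T N \<and> local_Hausdorff_converges Ds D"
      show "\<forall>\<^sub>F j in sequentially. Ds j \<in> ?X - T N"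
      proof (rule ccontr)
        assume "\<not> ?thesis"
        then have "\<exists>\<^sub>F j in sequentially. Ds j \<in> T N"
          using D by (auto simp: frequently_def image_subset_iff)
        then have often: "\<exists>j\<ge>i. Ds j \<in> T N" for i
          by (auto simp: frequently_sequentially)
        define J where "J = {j. Ds j \<in> T N}"
        have "infinite J"
          using often by (auto simp: J_def infinite_nat_iff_unbounded_le)
        define h where "h = enumerate J"
        have h: "strict_mono h" "\<And>i. Ds (h i) \<in> T N"
          using enumerate_in_set[OF \<open>infinite J\<close>] \<open>infinite J\<close>
          by (auto simp: h_def strict_mono_enumerate J_def)
        then have "\<forall>i. \<exists>n. Ds (h i) = \<Omega>s n"
          by (auto simp: T_def)
        then obtain m where m: "\<And>i. Ds (h i) = \<Omega>s (m i)" by metis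
        have conv: "local_Hausdorff_converges (Ds \<circ> h) D"
          using local_Hausdorff_converges_subseq D h(1) by blast
        show False
        proof (cases "finite (range m)")
          case True
          then obtain n where "infinite {i. m i = n}"
            using pigeonhole_infinite[of UNIV m] by auto
          then have g: "strict_mono (enumerate {i. m i = n})"
            and "m (enumerate {i. m i = n} i) = n" for i
            using enumerate_in_set by (auto simp: strict_mono_enumerate)
          then have "Ds \<circ> h \<circ> enumerate {i. m i = n} = (\<lambda>i. \<Omega>s n)"
            by (auto simp: m)
          then have "local_Hausdorff_converges (\<lambda>i. \<Omega>s n) D"
            using local_Hausdorff_converges_subseq[OF conv g] by simp
          then have "\<Omega>s n = D"
            using D assms(2)[of n] KX
            by (intro local_Hausdorff_const_unique) (auto simp: C_properly_convex_domains_def)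
          moreover have "\<Omega>s n \<in> T N"
            by (metis (no_types, lifting) \<open>Ds \<circ> h \<circ> enumerate {i. m i = n} = (\<lambda>i. \<Omega>s n)\<close> comp_apply h(2))
          ultimately show False using D by blast
        next
          case False
          \<comment> \<open>Infinitely many index values allow a later position with a larger index.
            Iterating this choice makes positions and indices strictly increasing together.\<close>
          have "\<exists>i'>i. m i' > m i" for i
          proof (rule ccontr)
            assume "\<not> ?thesis"
            then have "m j \<in> {..m i} \<union> m ` {..i}" for j
              by (metis UnI1 UnI2 atMost_iff imageI linorder_not_less)
            then have "range m \<subseteq> {..m i} \<union> m ` {..i}" by blast
            then show False using False by (meson finite_Un finite_atMost finite_imageI finite_subset)
          qed
          then obtain f where f: "\<And>i. f i > i" "\<And>i. m (f i) > m i" by metis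
          define g where "g i = (f ^^ i) 0" for i
          have "strict_mono g" "strict_mono (m \<circ> g)"
            by (auto simp: strict_mono_Suc_iff g_def f)
          moreover have "Ds \<circ> h \<circ> g = \<Omega>s \<circ> (m \<circ> g)"
            by (auto simp: m)
          ultimately show False
            using local_Hausdorff_converges_subseq[OF conv, of g] no[of "m \<circ> g" D] D by simp
        qed
      qed
    qed auto
    have cover: "\<K> \<subseteq> (\<Union>N. ?X - T N)"
    proof
      fix E assume "E \<in> \<K>"
      then obtain N where "\<forall>n\<ge>N. \<Omega>s n \<noteq> E" using repeat KX by blast
      then show "E \<in> (\<Union>N. ?X - T N)"
        using \<open>E \<in> \<K>\<close> KX by (fastforce simp: T_def)
    qed
    obtain F where F: "finite F" "F \<subseteq> range (\<lambda>N. ?X - T N)" "\<K> \<subseteq> \<Union>F"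
      using assms(1) op cover unfolding compactin_def
      by (metis (no_types, lifting) imageE)
    then obtain S where S: "finite S" "F = (\<lambda>N. ?X - T N) ` S"
      by (meson finite_subset_image)
    \<comment> \<open>The index is at least every \<open>N\<close> in \<open>S\<close>, so this term
      lies in all removed tails and escapes the subcover. Inserting 0 gives the maximum a meaning
      for empty \<open>S\<close>.\<close>
    have "\<Omega>s (Max (insert 0 S)) \<in> T N" if "N \<in> S" for N
      using S(1) that by (auto simp: T_def)
    then show False
      using F(3) assms(2) S by blast
  qed
  then show thesis using that by blast
qed

section \<open>Selection of convergent subsequences\<close>

text \<open>Radius and direction of an affine disc are encoded in the single vector
  \<open>v\<close>, so that statements about size become statements about scaling
  \<open>v\<close>.\<close>

definition complex_disc :: "complex ^ 'd \<Rightarrow> complex ^ 'd \<Rightarrow> (complex ^ 'd) set" where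
  "complex_disc z v = (\<lambda>c. z + c *s v) ` ball 0 1"

lemma scaleR_eq_smult: "t *\<^sub>R (v :: complex ^ 'd) = of_real t *s v"
  unfolding vec_eq_iff vector_scaleR_component vector_smult_component
  by (simp add: scaleR_conv_of_real)

lemma norm_smult: "norm (c *s (v :: complex ^ 'd)) = norm c * norm v"
  by (simp add: norm_vec_def norm_mult L2_set_right_distrib)

text \<open>Axioms of the Minkowski functional of a convex set containing
  \<open>ball 0 \<epsilon>\<close>. Homogeneity is positive only, since the sets need not be
  symmetric. All conditions survive pointwise limits.\<close>

definition gauge_functional :: "real \<Rightarrow> ('a::real_normed_vector \<Rightarrow> real) \<Rightarrow> bool" where
  "gauge_functional \<epsilon> G \<longleftrightarrow> (\<forall>x y. G (x + y) \<le> G x + G y) \<and>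
     (\<forall>t\<ge>0. \<forall>x. G (t *\<^sub>R x) = t * G x) \<and> (\<forall>x. 0 \<le> G x \<and> G x \<le> norm x / \<epsilon>)"

text \<open>Subadditivity for \<open>x = y + (x - y)\<close>, and with the roles exchanged, turns
  the norm bound into a Lipschitz constant depending on \<open>\<epsilon>\<close> alone.\<close>

lemma gauge_functional_lipschitz:
  assumes "gauge_functional \<epsilon> G"
  shows "\<bar>G x - G y\<bar> \<le> norm (x - y) / \<epsilon>"
proof -
  have tri: "G (a + b) \<le> G a + G b" "G a \<le> norm a / \<epsilon>" for a b
    using assms by (auto simp: gauge_functional_def)
  show ?thesis
    using tri(1)[of y "x - y"] tri(1)[of x "y - x"] tri(2)[of "x - y"] tri(2)[of "y - x"]
    by (simp add: norm_minus_commute)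
qed

lemma gauge_functional_continuous:
  assumes "gauge_functional \<epsilon> G" "\<epsilon> > 0"
  shows "continuous_on UNIV G"
proof -
  have "(1/\<epsilon>)-lipschitz_on UNIV G"
    using gauge_functional_lipschitz[OF assms(1)] assms(2)
    by (intro lipschitz_onI) (auto simp: dist_norm)
  then show ?thesis by (rule lipschitz_on_continuous_on)
qed

lemma gauge_functional_closure:
  assumes "gauge_functional \<epsilon> G" "\<epsilon> > 0"
  shows "closure {x. G x < 1} = {x. G x \<le> 1}"
proof
  have "closed {x. G x \<le> 1}"
    using gauge_functional_continuous[OF assms] by (intro closed_Collect_le) (auto simp: continuous_on_const)
  then show "closure {x. G x < 1} \<subseteq> {x. G x \<le> 1}"
    by (intro closure_minimal) auto
  show "{x. G x \<le> 1} \<subseteq> closure {x. G x < 1}"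
  proof
    fix x assume x: "x \<in> {x. G x \<le> 1}"
    define y where "y n = (1 - inverse (real (Suc n))) *\<^sub>R x" for n
    have "y n \<in> {x. G x < 1}" for n
    proof -
      have t: "0 \<le> 1 - inverse (real (Suc n))" "1 - inverse (real (Suc n)) < 1"
        by (auto simp: field_simps)
      then have "G (y n) = (1 - inverse (real (Suc n))) * G x"
        using assms(1) unfolding gauge_functional_def y_def by blast
      also have "\<dots> \<le> 1 - inverse (real (Suc n))"
        using t x by (simp add: mult_left_le)
      also have "\<dots> < 1" by (rule t(2))
      finally show ?thesis by simp
    qed
    moreover have "y \<longlonglongrightarrow> (1 - 0) *\<^sub>R x"
      unfolding y_def by (intro tendsto_intros LIMSEQ_inverse_real_of_nat)
    ultimately show "x \<in> closure {x. G x < 1}"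
      by (auto simp: closure_sequential)
  qed
qed

lemma gauge_functional_sublevel:
  assumes "gauge_functional \<epsilon> G" "\<epsilon> > 0"
  shows "open {x. G x < 1}" "convex {x. G x < 1}" "0 \<in> {x. G x < 1}"
proof -
  show "open {x. G x < 1}"
    using gauge_functional_continuous[OF assms] by (intro open_Collect_less) (auto simp: continuous_on_const)
  show "convex {x. G x < 1}"
  proof (rule convexI)
    fix x y :: 'a and u v :: real
    assume *: "x \<in> {x. G x < 1}" "y \<in> {x. G x < 1}" "0 \<le> u" "0 \<le> v" "u + v = 1"
    have "G (u *\<^sub>R x + v *\<^sub>R y) \<le> u * G x + v * G y"
      using assms(1) * unfolding gauge_functional_def by metis
    also have "\<dots> < 1"
      using * convex_bound_lt[of "G x" 1 "G y" u v] by simp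
    finally show "u *\<^sub>R x + v *\<^sub>R y \<in> {x. G x < 1}" by simp
  qed
  have "G 0 \<le> norm (0::'a) / \<epsilon>"
    using assms(1) unfolding gauge_functional_def by blast
  then show "0 \<in> {x. G x < 1}" by simp
qed

text \<open>\<open>G\<close> is the Minkowski functional, the infimum of all \<open>t > 0\<close>
  with \<open>x / t\<close> in \<open>\<Omega>\<close>. Convexity yields subadditivity, the ball
  yields the norm bound, and openness makes the sublevel inequality strict.\<close>

lemma convex_open_gauge_functional:
  fixes \<Omega> :: "'a::real_normed_vector set"
  assumes "open \<Omega>" "convex \<Omega>" "\<epsilon> > 0" "ball 0 \<epsilon> \<subseteq> \<Omega>"
  obtains G where "gauge_functional \<epsilon> G" "\<Omega> = {x. G x < 1}"
proof -
  define T where "T x = {t. 0 < t \<and> inverse t *\<^sub>R x \<in> \<Omega>}" for x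
  define G where "G x = Inf (T x)" for x
  have T_large: "t \<in> T x" if "t > norm x / \<epsilon>" for t x
  proof -
    have "t > 0" using that \<open>\<epsilon> > 0\<close> by (smt (verit) divide_nonneg_pos norm_ge_zero)
    then have "norm (inverse t *\<^sub>R x) < \<epsilon>"
      using that \<open>\<epsilon> > 0\<close> by (simp add: field_simps)
    then show ?thesis using assms(4) \<open>t > 0\<close> by (auto simp: T_def)
  qed
  have T_ne: "T x \<noteq> {}" for x
    using T_large[of x "norm x / \<epsilon> + 1"] by force
  have G_le: "G x \<le> t" if "t \<in> T x" for x t
    unfolding G_def using that by (intro cInf_lower bdd_belowI[of _ 0]) (auto simp: T_def)
  have G_ge: "b \<le> G x" if "\<And>t. t \<in> T x \<Longrightarrow> b \<le> t" for x b
    unfolding G_def using that T_ne by (intro cInf_greatest) auto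
  have G_nonneg: "0 \<le> G x" for x
    by (rule G_ge) (auto simp: T_def)
  have G_norm: "G x \<le> norm x / \<epsilon>" for x
    by (rule dense_ge) (use G_le T_large in blast)
  have "0 \<in> \<Omega>" using assms(3,4) by auto
  have T_add: "s + t \<in> T (x + y)" if "s \<in> T x" "t \<in> T y" for s t x y
  proof -
    have st: "0 < s" "0 < t" "inverse s *\<^sub>R x \<in> \<Omega>" "inverse t *\<^sub>R y \<in> \<Omega>"
      using that by (auto simp: T_def)
    have "(s / (s+t)) *\<^sub>R (inverse s *\<^sub>R x) + (t / (s+t)) *\<^sub>R (inverse t *\<^sub>R y) \<in> \<Omega>"
      using st by (intro convexD[OF assms(2)]) (auto simp: add_divide_distrib[symmetric])
    moreover have "s / (s+t) * inverse s = inverse (s+t)" "t / (s+t) * inverse t = inverse (s+t)"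
      using st by (auto simp: divide_simps)
    then have "(s / (s+t)) *\<^sub>R (inverse s *\<^sub>R x) + (t / (s+t)) *\<^sub>R (inverse t *\<^sub>R y)
        = inverse (s+t) *\<^sub>R (x + y)"
      by (simp add: scaleR_add_right)
    ultimately show ?thesis using st by (auto simp: T_def)
  qed
  have G_add: "G (x + y) \<le> G x + G y" for x y
  proof -
    have "G (x + y) - t \<le> G x" if "t \<in> T y" for t
      by (rule G_ge) (use G_le[OF T_add[OF _ that]] in force)
    then have "G (x + y) - G x \<le> G y"
      by (intro G_ge) force
    then show ?thesis by simp
  qed
  have G_scale_le: "G (t *\<^sub>R x) \<le> t * G x" if "t > 0" for t x
  proof -
    have "G (t *\<^sub>R x) / t \<le> G x"
    proof (rule G_ge)
      fix s assume "s \<in> T x"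
      moreover have "inverse (t * s) *\<^sub>R t *\<^sub>R x = inverse s *\<^sub>R x"
        using that by (simp add: divide_simps)
      ultimately have "t * s \<in> T (t *\<^sub>R x)"
        using that unfolding T_def mem_Collect_eq by (metis mult_pos_pos)
      then show "G (t *\<^sub>R x) / t \<le> s" using G_le that by (simp add: field_simps)
    qed
    then show ?thesis using that by (simp add: field_simps)
  qed
  have G_scale: "G (t *\<^sub>R x) = t * G x" if "t \<ge> 0" for t x
  proof (cases "t = 0")
    case True
    then show ?thesis using G_norm[of 0] G_nonneg[of 0] by simp
  next
    case False
    then have "G x \<le> inverse t * G (t *\<^sub>R x)"
      using G_scale_le[of "inverse t" "t *\<^sub>R x"] that by simp
    then have "t * G x \<le> G (t *\<^sub>R x)"
      using False that by (simp add: field_simps)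
    then show ?thesis using G_scale_le[of t x] False that by simp
  qed
  have "gauge_functional \<epsilon> G"
    using G_add G_scale G_nonneg G_norm by (auto simp: gauge_functional_def)
  moreover have "\<Omega> = {x. G x < 1}"
  proof (intro equalityI subsetI)
    fix x assume "x \<in> \<Omega>"
    then obtain e where e: "e > 0" "ball x e \<subseteq> \<Omega>" using assms(1) open_contains_ball by blast
    \<comment> \<open>Small enough that \<open>(1 + \<eta>) x\<close> stays in the ball about
      \<open>x\<close>; the summand 1 keeps the denominator positive at
      \<open>x = 0\<close>.\<close>
    define \<eta> where "\<eta> = e / (2 * (norm x + 1))"
    have "\<eta> > 0" using e by (simp add: \<eta>_def add_nonneg_pos)
    have "\<eta> * norm x < e"
    proof -
      have "\<eta> * norm x \<le> \<eta> * (norm x + 1)" using \<open>\<eta> > 0\<close> by simp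
      also have "\<dots> = e / 2"
        using add_nonneg_pos[OF norm_ge_zero[of x] zero_less_one]
        by (simp add: \<eta>_def del: distrib_left_numeral mult_2)
      finally show ?thesis using e by simp
    qed
    then have "(1 + \<eta>) *\<^sub>R x \<in> ball x e"
      using \<open>\<eta> > 0\<close> by (simp add: dist_norm algebra_simps)
    then have "inverse (1 + \<eta>) \<in> T x"
      using e \<open>\<eta> > 0\<close> by (auto simp: T_def)
    then have "G x \<le> inverse (1 + \<eta>)" by (rule G_le)
    also have "\<dots> < 1" using \<open>\<eta> > 0\<close> by (simp add: inverse_less_1_iff)
    finally show "x \<in> {x. G x < 1}" by simp
  next
    fix x assume "x \<in> {x. G x < 1}"
    then obtain t where t: "t \<in> T x" "t < 1"
      using cInf_lessD[OF T_ne[of x]] by (auto simp: G_def)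
    then have "t *\<^sub>R (inverse t *\<^sub>R x) + (1 - t) *\<^sub>R 0 \<in> \<Omega>"
      using \<open>0 \<in> \<Omega>\<close> by (intro convexD[OF assms(2)]) (auto simp: T_def)
    then show "x \<in> \<Omega>" using t by (simp add: T_def)
  qed
  ultimately show thesis by (rule that)
qed

text \<open>The common Lipschitz bound makes Arzela-Ascoli applicable on the closed unit ball.
  Homogeneity spreads the uniform limit to the whole space, with an error proportional to the
  norm.\<close>

lemma gauge_functional_convergent_subseq:
  fixes g :: "nat \<Rightarrow> 'a::euclidean_space \<Rightarrow> real"
  assumes "\<And>n. gauge_functional \<epsilon> (g n)" "\<epsilon> > 0"
  obtains k G where "strict_mono (k :: nat \<Rightarrow> nat)" "gauge_functional \<epsilon> G"
    "\<And>\<eta>. \<eta> > 0 \<Longrightarrow> \<forall>\<^sub>F n in sequentially. \<forall>x. \<bar>g (k n) x - G x\<bar> \<le> \<eta> * norm x"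
proof -
  have g: "g n (x + y) \<le> g n x + g n y" "t \<ge> 0 \<Longrightarrow> g n (t *\<^sub>R x) = t * g n x"
    "0 \<le> g n x" "g n x \<le> norm x / \<epsilon>" for n x y t
    using assms(1)[of n] unfolding gauge_functional_def by blast+
  have bd: "norm (g n x) \<le> 1 / \<epsilon>" if "x \<in> cball 0 1" for n x
  proof -
    have "norm x / \<epsilon> \<le> 1 / \<epsilon>" using that assms(2) by (simp add: divide_right_mono)
    then show ?thesis using g(3,4)[of n x] by simp
  qed
  have eq: "\<exists>d. 0 < d \<and> (\<forall>n y. y \<in> cball 0 1 \<and> norm (x - y) < d \<longrightarrow> norm (g n x - g n y) < e)"
    if "x \<in> cball 0 1" "0 < e" for x :: 'a and e
  proof (intro exI conjI allI impI)
    show "0 < e * \<epsilon>" using that assms by simp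
    fix n y assume "y \<in> cball 0 1 \<and> norm (x - y) < e * \<epsilon>"
    then have "norm (x - y) / \<epsilon> < e" using assms(2) by (simp add: field_simps)
    then show "norm (g n x - g n y) < e"
      using gauge_functional_lipschitz[OF assms(1)[of n], of x y] by simp
  qed
  obtain \<gamma> k where k: "strict_mono (k :: nat \<Rightarrow> nat)"
    "\<And>e. 0 < e \<Longrightarrow> \<exists>N. \<forall>n x. n \<ge> N \<and> x \<in> cball 0 1 \<longrightarrow> norm (g (k n) x - \<gamma> x) < e"
  proof (rule Arzela_Ascoli[of "cball 0 1" g "1 / \<epsilon>"])
    fix \<gamma> and k :: "nat \<Rightarrow> nat"
    assume "strict_mono k" "\<And>e. 0 < e \<Longrightarrow> \<exists>N. \<forall>n x. n \<ge> N \<and> x \<in> cball 0 1 \<longrightarrow> norm (g (k n) x - \<gamma> x) < e"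
    then show thesis by (rule that)
  qed (use bd eq in auto)
  \<comment> \<open>\<open>\<gamma>\<close> is controlled on the unit ball only, so \<open>G\<close>
    is the positively homogeneous extension of its values on the sphere. The factor
    \<open>norm x\<close> gives \<open>G 0 = 0\<close>.\<close>
  define G where "G x = norm x * \<gamma> (sgn x)" for x
  have unif: "\<forall>\<^sub>F n in sequentially. \<forall>x. \<bar>g (k n) x - G x\<bar> \<le> \<eta> * norm x" if "\<eta> > 0" for \<eta>
  proof -
    obtain N where N: "\<And>n x. n \<ge> N \<Longrightarrow> x \<in> cball 0 1 \<Longrightarrow> norm (g (k n) x - \<gamma> x) < \<eta>"
      using k(2)[OF \<open>\<eta> > 0\<close>] by blast
    have "\<bar>g (k n) x - G x\<bar> \<le> \<eta> * norm x" if "n \<ge> N" for n x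
    proof -
      have "norm x *\<^sub>R sgn x = x"
        by (cases "x = 0") (simp_all add: sgn_div_norm)
      then have "g (k n) x = norm x * g (k n) (sgn x)"
        using g(2)[of "norm x" "k n" "sgn x"] by simp
      then have "\<bar>g (k n) x - G x\<bar> = norm x * \<bar>g (k n) (sgn x) - \<gamma> (sgn x)\<bar>"
        by (simp add: G_def right_diff_distrib[symmetric] abs_mult)
      also have "\<dots> \<le> norm x * \<eta>"
        using N[OF that, of "sgn x"] by (intro mult_left_mono) (cases "x = 0"; simp add: norm_sgn)+
      finally show ?thesis by (simp add: mult.commute)
    qed
    then show ?thesis by (auto simp: eventually_sequentially)
  qed
  have lim: "(\<lambda>n. g (k n) x) \<longlonglongrightarrow> G x" for x
  proof (rule tendstoI)
    fix e :: real assume "e > 0"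
    define \<eta> where "\<eta> = e / (norm x + 1)"
    have \<eta>: "\<eta> > 0" "\<eta> * norm x < e"
      using \<open>e > 0\<close> by (auto simp: \<eta>_def add_nonneg_pos divide_less_eq) 
    show "\<forall>\<^sub>F n in sequentially. dist (g (k n) x) (G x) < e"
      using unif[OF \<eta>(1)] by (rule eventually_mono) (metis \<eta>(2) dist_real_def le_less_trans)
  qed
  have "gauge_functional \<epsilon> G"
    unfolding gauge_functional_def
  proof (intro conjI allI impI)
    fix x y
    show "G (x + y) \<le> G x + G y"
      by (rule LIMSEQ_le[OF lim tendsto_add[OF lim lim]]) (use g(1) in blast)
    show "0 \<le> G x" by (rule LIMSEQ_le_const[OF lim]) (use g(3) in blast)
    show "G x \<le> norm x / \<epsilon>" by (rule LIMSEQ_le_const2[OF lim]) (use g(4) in blast)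
  next
    fix t :: real and x assume "t \<ge> 0"
    then have "(\<lambda>n. g (k n) (t *\<^sub>R x)) \<longlonglongrightarrow> t * G x"
      using tendsto_mult_left[OF lim[of x], of t] by (simp add: g(2))
    then show "G (t *\<^sub>R x) = t * G x" using lim LIMSEQ_unique by blast
  qed
  then show thesis using that k(1) unif by blast
qed

text \<open>Scaling by \<open>t = 1 / (1 + \<eta> R)\<close> compensates the excess of
  \<open>g'\<close> over \<open>g\<close> on the ball of radius \<open>R\<close>. It moves the point
  by at most \<open>(1 - t) R\<close>, and \<open>1 - t \<le> \<eta> R\<close>.\<close>

lemma gauge_functional_sublevel_near:
  assumes g: "gauge_functional \<epsilon> g" "\<epsilon> > 0" and g': "gauge_functional \<epsilon> g'"
    and near: "\<And>x. \<bar>g x - g' x\<bar> \<le> \<eta> * norm x" and "\<eta> \<ge> 0" "R \<ge> 0"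
    and a: "a \<in> closure {x. g x < 1} \<inter> cball 0 R"
  shows "\<exists>b \<in> closure {x. g' x < 1} \<inter> cball 0 R. dist a b \<le> \<eta> * R * R"
proof -
  define t where "t = inverse (1 + \<eta> * R)"
  have t: "0 < t" "t \<le> 1" using \<open>\<eta> \<ge> 0\<close> \<open>R \<ge> 0\<close> by (auto simp: t_def inverse_le_1_iff add_pos_nonneg)
  have aR: "g a \<le> 1" "norm a \<le> R"
    using a gauge_functional_closure[OF g] by auto
  have "g' a \<le> 1 + \<eta> * R"
    using near[of a] aR mult_left_mono[OF aR(2) \<open>\<eta> \<ge> 0\<close>] by linarith
  moreover have "1 + \<eta> * R > 0" using \<open>\<eta> \<ge> 0\<close> \<open>R \<ge> 0\<close> by (simp add: add_pos_nonneg)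
  ultimately have "t * g' a \<le> 1"
    by (simp add: t_def field_simps)
  moreover have "g' (t *\<^sub>R a) = t * g' a"
    using g' t unfolding gauge_functional_def by auto
  ultimately have "t *\<^sub>R a \<in> closure {x. g' x < 1}"
    using gauge_functional_closure[OF g' g(2)] by auto
  moreover have "norm (t *\<^sub>R a) \<le> R"
    using t aR mult_mono[of t 1 "norm a" R] by simp
  moreover have "dist a (t *\<^sub>R a) \<le> \<eta> * R * R"
  proof -
    have "1 - t = t * (\<eta> * R)" using \<open>1 + \<eta> * R > 0\<close> by (simp add: t_def field_simps)
    also have "\<dots> \<le> \<eta> * R" using t \<open>\<eta> \<ge> 0\<close> \<open>R \<ge> 0\<close> by (simp add: mult_left_le_one_le)
    finally have "1 - t \<le> \<eta> * R" .
    have "a - t *\<^sub>R a = (1 - t) *\<^sub>R a" by (simp add: algebra_simps)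
    then have "dist a (t *\<^sub>R a) = (1 - t) * norm a" using t by (simp add: dist_norm)
    also have "\<dots> \<le> \<eta> * R * R"
      using t aR \<open>1 - t \<le> \<eta> * R\<close> by (intro mult_mono) auto
    finally show ?thesis .
  qed
  ultimately show ?thesis by (intro bexI[of _ "t *\<^sub>R a"]) auto
qed

text \<open>The common ball bounds the gauges, so a subsequence of them converges to some
  \<open>G\<close>, and \<open>D\<close> is its open sublevel set. The bound on discs at the origin
  keeps \<open>G\<close> from vanishing on a complex line through the origin, so \<open>D\<close>
  contains no complex line.\<close>

lemma local_Hausdorff_selection:
  fixes \<Omega>s :: "nat \<Rightarrow> (complex ^ 'd) set"
  assumes \<Omega>s: "\<And>n. open (\<Omega>s n)" "\<And>n. convex (\<Omega>s n)" "\<And>n. ball 0 \<epsilon> \<subseteq> \<Omega>s n" and "\<epsilon> > 0"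
    and bound: "\<And>n v. complex_disc 0 v \<subseteq> \<Omega>s n \<Longrightarrow> norm v \<le> B"
  obtains k D where "strict_mono (k :: nat \<Rightarrow> nat)" "D \<in> C_properly_convex_domains"
    "local_Hausdorff_converges (\<Omega>s \<circ> k) D"
proof -
  have "\<exists>G. gauge_functional \<epsilon> G \<and> \<Omega>s n = {x. G x < 1}" for n
    using convex_open_gauge_functional[OF \<Omega>s(1,2) \<open>\<epsilon> > 0\<close> \<Omega>s(3)] by metis
  then obtain g where g: "\<And>n. gauge_functional \<epsilon> (g n)" "\<And>n. \<Omega>s n = {x. g n x < 1}" by metis
  obtain k G where k: "strict_mono (k :: nat \<Rightarrow> nat)" and G: "gauge_functional \<epsilon> G"
    and unif: "\<And>\<eta>. \<eta> > 0 \<Longrightarrow> \<forall>\<^sub>F n in sequentially. \<forall>x. \<bar>g (k n) x - G x\<bar> \<le> \<eta> * norm x"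
    using gauge_functional_convergent_subseq[of \<epsilon> g] g(1) \<open>\<epsilon> > 0\<close> by blast
  define D where "D = {x. G x < 1}"
  have "(\<lambda>n. Hausdorff_dist (closure (\<Omega>s (k n)) \<inter> cball 0 R) (closure D \<inter> cball 0 R)) \<longlonglongrightarrow> 0"
    if "R \<ge> 0" for R
  proof (rule tendsto_ennreal_zeroI)
    fix e :: real assume "e > 0"
    define \<eta> where "\<eta> = e / (R * R + 1)"
    have "R * R + 1 > 0" by (simp add: add_nonneg_pos)
    then have \<eta>: "\<eta> > 0" "\<eta> * R * R \<le> e"
      using \<open>e > 0\<close> by (auto simp: \<eta>_def divide_le_eq algebra_simps)
    show "\<forall>\<^sub>F n in sequentially.
        Hausdorff_dist (closure (\<Omega>s (k n)) \<inter> cball 0 R) (closure D \<inter> cball 0 R) \<le> ennreal e"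
      using unif[OF \<eta>(1)]
    proof (rule eventually_mono)
      fix n assume *: "\<forall>x. \<bar>g (k n) x - G x\<bar> \<le> \<eta> * norm x"
      then have *: "\<And>x. \<bar>g (k n) x - G x\<bar> \<le> \<eta> * norm x" "\<And>x. \<bar>G x - g (k n) x\<bar> \<le> \<eta> * norm x"
        by (auto simp: abs_minus_commute)
      have "Hausdorff_dist (closure (\<Omega>s (k n)) \<inter> cball 0 R) (closure D \<inter> cball 0 R) \<le> ennreal (\<eta> * R * R)"
      proof (rule Hausdorff_dist_le)
        fix a assume "a \<in> closure (\<Omega>s (k n)) \<inter> cball 0 R"
        then show "\<exists>b \<in> closure D \<inter> cball 0 R. dist a b \<le> \<eta> * R * R"
          using gauge_functional_sublevel_near[OF g(1) \<open>\<epsilon> > 0\<close> G *(1), of R a] \<eta> that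
          by (auto simp: g(2) D_def)
      next
        fix b assume "b \<in> closure D \<inter> cball 0 R"
        then show "\<exists>a \<in> closure (\<Omega>s (k n)) \<inter> cball 0 R. dist a b \<le> \<eta> * R * R"
          using gauge_functional_sublevel_near[OF G \<open>\<epsilon> > 0\<close> g(1) *(2), of R b] \<eta> that
          by (auto simp: g(2) D_def dist_commute)
      qed
      also have "\<dots> \<le> ennreal e" using \<eta> by (intro ennreal_leI)
      finally show "Hausdorff_dist (closure (\<Omega>s (k n)) \<inter> cball 0 R) (closure D \<inter> cball 0 R) \<le> ennreal e" .
    qed
  qed
  then have "local_Hausdorff_converges (\<Omega>s \<circ> k) D"
    unfolding local_Hausdorff_converges_def by (intro exI[of _ 0]) auto
  moreover have "D \<in> C_properly_convex_domains"
    unfolding C_properly_convex_domains_def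
  proof (intro CollectI conjI allI impI)
    show "open D" "convex D" "D \<noteq> {}"
      using gauge_functional_sublevel[OF G \<open>\<epsilon> > 0\<close>] by (auto simp: D_def)
    fix z v :: "complex ^ 'd" assume "v \<noteq> 0"
    show "\<not> complex_line z v \<subseteq> D"
    proof
      assume line: "complex_line z v \<subseteq> D"
      have Gs: "G (x + y) \<le> G x + G y" "t \<ge> 0 \<Longrightarrow> G (t *\<^sub>R x) = t * G x" "0 \<le> G x" for x y t
        using G unfolding gauge_functional_def by blast+
      \<comment> \<open>On a line inside \<open>D\<close> the gauge is bounded; after translating by
        \<open>- z\<close>, homogeneity forces it to vanish on all complex multiples of
        \<open>v\<close>.\<close>
      have bd: "G (c *s v) \<le> 1 + G (- z)" for c
      proof -
        have "z + c *s v \<in> D" using line by (auto simp: complex_line_def)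
        then have "G (z + c *s v) < 1" by (simp add: D_def)
        then show ?thesis using Gs(1)[of "z + c *s v" "- z"] by simp
      qed
      have zero: "G (c *s v) = 0" for c
      proof (rule ccontr)
        assume "G (c *s v) \<noteq> 0"
        then have pos: "G (c *s v) > 0" using Gs(3)[of "c *s v"] by simp
        define t where "t = (2 + G (- z)) / G (c *s v)"
        have "t \<ge> 0" using pos Gs(3)[of "- z"] by (simp add: t_def)
        moreover have "(of_real t * c) *s v = t *\<^sub>R (c *s v)"
          by (simp add: scaleR_eq_smult vector_smult_assoc)
        ultimately have "G ((of_real t * c) *s v) = 2 + G (- z)"
          using Gs(2)[of t "c *s v"] pos by (simp add: t_def)
        then show False using bd[of "of_real t * c"] by simp
      qed
      \<comment> \<open>A multiple of \<open>v\<close> longer than \<open>B\<close>. With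
        \<open>\<eta>\<close> the reciprocal of its length, \<open>g (k n)\<close> is below 1 on the
        whole disc spanned by \<open>w\<close>, against the bound on discs.\<close>
      define w where "w = ((\<bar>B\<bar> + 1) / norm v) *\<^sub>R v"
      have "norm w = \<bar>B\<bar> + 1" using \<open>v \<noteq> 0\<close> by (simp add: w_def)
      define \<eta> where "\<eta> = 1 / (\<bar>B\<bar> + 1)"
      have "\<eta> > 0" by (simp add: \<eta>_def)
      then obtain n where n: "\<And>x. \<bar>g (k n) x - G x\<bar> \<le> \<eta> * norm x"
        using eventually_happens'[OF sequentially_bot unif] by blast
      have "complex_disc 0 w \<subseteq> \<Omega>s (k n)"
      proof
        fix x assume "x \<in> complex_disc 0 w"
        then obtain c where c: "norm c < 1" "x = c *s w" by (auto simp: complex_disc_def)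
        have "x = (of_real ((\<bar>B\<bar> + 1) / norm v) * c) *s v"
          by (simp add: c w_def scaleR_eq_smult vector_smult_assoc mult.commute)
        then have "G x = 0" using zero by metis
        moreover have "norm x = norm c * norm w"
          by (simp add: c norm_smult)
        then have "\<eta> * norm x = norm c"
          using \<open>norm w = \<bar>B\<bar> + 1\<close> \<open>\<eta> > 0\<close> by (simp add: \<eta>_def)
        ultimately have "g (k n) x \<le> norm c"
          using n[of x] by simp
        then show "x \<in> \<Omega>s (k n)" using c by (simp add: g(2))
      qed
      then show False using bound[of w "k n"] \<open>norm w = \<bar>B\<bar> + 1\<close> by simp
    qed
  qed
  ultimately show thesis using that k by blast
qed

section \<open>Complex discs in convex domains\<close>

lemma complex_disc_subset_iff:
  "complex_disc z v \<subseteq> S \<longleftrightarrow> (\<forall>c. norm c < 1 \<longrightarrow> z + c *s v \<in> S)"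
  unfolding complex_disc_def image_subset_iff by (simp add: Ball_def)

lemma complex_disc_scaleR_subset:
  fixes v :: "complex ^ 'd"
  assumes "complex_disc z v \<subseteq> S" "\<bar>t\<bar> \<le> 1"
  shows "complex_disc z (t *\<^sub>R v) \<subseteq> S"
  unfolding complex_disc_subset_iff
proof (intro allI impI)
  fix c :: complex assume "norm c < 1"
  then have "norm (c * of_real t) < 1"
    using assms(2) mult_left_le[of "\<bar>t\<bar>" "norm c"] by (simp add: norm_mult)
  then show "z + c *s (t *\<^sub>R v) \<in> S"
    using assms(1) by (simp add: complex_disc_subset_iff scaleR_eq_smult vector_smult_assoc)
qed

lemma complex_disc_subset_ball:
  fixes v :: "complex ^ 'd"
  assumes "norm v \<le> r" "r > 0"
  shows "complex_disc z v \<subseteq> ball z r"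
  unfolding complex_disc_subset_iff
proof (intro allI impI)
  fix c :: complex assume "norm c < 1"
  have "norm c * norm v \<le> norm c * r" using assms by (intro mult_left_mono) auto
  also have "\<dots> < r" using \<open>norm c < 1\<close> assms by simp
  finally have "norm c * norm v < r" .
  then show "z + c *s v \<in> ball z r"
    by (simp add: dist_norm norm_smult)
qed

text \<open>A closed convex set containing a line contains its translate through each of its points.
  Translating the line to an interior point and halving parameters places it in
  \<open>\<Omega>\<close> itself.\<close>

lemma C_properly_convex_no_line_in_closure:
  fixes u :: "complex ^ 'd"
  assumes "\<Omega> \<in> C_properly_convex_domains" "\<And>c. z + c *s u \<in> closure \<Omega>"
  shows "u = 0"
proof -
  have \<Omega>: "\<Omega> \<noteq> {}" "open \<Omega>" "convex \<Omega>"
    and no_line: "\<And>z v. v \<noteq> 0 \<Longrightarrow> \<not> complex_line z v \<subseteq> \<Omega>"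
    using assms(1) by (auto simp: C_properly_convex_domains_def)
  obtain x where x: "x \<in> \<Omega>" using \<Omega> by blast
  have cl: "x + c *s u \<in> closure \<Omega>" for c
  proof -
    \<comment> \<open>Convex combinations of \<open>x\<close> with the far point of parameter
      \<open>c / t n\<close> on the given line keep the displacement \<open>c *s u\<close>, while
      their base point tends to \<open>x\<close>.\<close>
    define t where "t n = inverse (real (Suc n))" for n
    define y where "y n = (1 - t n) *\<^sub>R x + t n *\<^sub>R z + c *s u" for n
    have "y n \<in> closure \<Omega>" for n
    proof -
      have t: "0 < t n" "t n \<le> 1" by (auto simp: t_def field_simps)
      have "(1 - t n) *\<^sub>R x + t n *\<^sub>R (z + (of_real (inverse (t n)) * c) *s u) \<in> closure \<Omega>"
        using t x assms(2) closure_subset by (intro convexD[OF convex_closure[OF \<Omega>(3)]]) auto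
      moreover have "t n *\<^sub>R ((of_real (inverse (t n)) * c) *s u) = c *s u"
        using t by (simp add: scaleR_eq_smult vector_smult_assoc)
      ultimately show ?thesis by (simp add: y_def scaleR_add_right add.assoc)
    qed
    moreover have "y \<longlonglongrightarrow> (1 - 0) *\<^sub>R x + 0 *\<^sub>R z + c *s u"
      unfolding y_def t_def by (intro tendsto_intros LIMSEQ_inverse_real_of_nat)
    ultimately have "(1 - 0) *\<^sub>R x + 0 *\<^sub>R z + c *s u \<in> closure \<Omega>"
      using closed_sequentially[OF closed_closure] by blast
    then show ?thesis by simp
  qed
  have "x + c *s u \<in> \<Omega>" for c
  proof -
    \<comment> \<open>The midpoint of the interior point \<open>x\<close> and the closure point with
      parameter \<open>2 * c\<close> is interior.\<close>
    have "x + (2 * c) *s u - (1/2) *\<^sub>R (x + (2 * c) *s u - x) \<in> interior \<Omega>"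
      using \<Omega> x cl by (intro mem_interior_closure_convex_shrink) (auto simp: interior_open)
    moreover have "x + (2 * c) *s u - (1/2) *\<^sub>R (x + (2 * c) *s u - x) = x + c *s u"
      by (simp add: scaleR_eq_smult vector_smult_assoc vec_eq_iff)
    ultimately show ?thesis using interior_subset by (metis subsetD)
  qed
  then have "complex_line x u \<subseteq> \<Omega>" by (auto simp: complex_line_def)
  then show ?thesis using no_line by blast
qed

lemma tendsto_smult:
  fixes u :: "nat \<Rightarrow> complex ^ 'd"
  assumes "u \<longlonglongrightarrow> l"
  shows "(\<lambda>n. c *s u n) \<longlonglongrightarrow> c *s l"
proof (rule vec_tendstoI)
  fix i show "(\<lambda>n. (c *s u n) $ i) \<longlonglongrightarrow> (c *s l) $ i"
    unfolding vector_smult_component by (intro tendsto_intros tendsto_vec_nth assms)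
qed

text \<open>Discs with bounded centres and radii at least \<open>n\<close> would, after normalizing
  directions and passing to a subsequence, produce a complex line in
  \<open>closure \<Omega>\<close>. The weak conclusion suits sequences chosen in proofs by
  contradiction.\<close>

lemma local_Hausdorff_complex_disc_bounded:
  fixes \<Omega>s :: "nat \<Rightarrow> (complex ^ 'd) set"
  assumes "local_Hausdorff_converges \<Omega>s \<Omega>" "\<Omega> \<in> C_properly_convex_domains"
    and z: "\<And>n. norm (z n) \<le> M" and disc: "\<And>n. complex_disc (z n) (v n) \<subseteq> \<Omega>s n"
  shows "\<exists>n. norm (v n) < real n"
proof (rule ccontr)
  assume "\<nexists>n. norm (v n) < real n"
  then have v: "norm (v n) \<ge> real n" for n by (meson not_le)
  have "bounded (range (\<lambda>n. (z n, sgn (v n))))"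
  proof (rule boundedI)
    fix x assume "x \<in> range (\<lambda>n. (z n, sgn (v n)))"
    then obtain n where "x = (z n, sgn (v n))" by auto
    then show "norm x \<le> M + 1"
      using norm_Pair_le[of "z n" "sgn (v n)"] z[of n] by (auto simp: norm_sgn split: if_splits)
  qed
  then obtain l k where k: "strict_mono (k :: nat \<Rightarrow> nat)" "((\<lambda>n. (z n, sgn (v n))) \<circ> k) \<longlonglongrightarrow> l"
    using bounded_imp_convergent_subsequence by blast
  obtain a u where "l = (a, u)" by (cases l)
  have za: "(\<lambda>n. z (k n)) \<longlonglongrightarrow> a" and vu: "(\<lambda>n. sgn (v (k n))) \<longlonglongrightarrow> u"
    using tendsto_fst[OF k(2)] tendsto_snd[OF k(2)] by (auto simp: o_def \<open>l = (a, u)\<close>)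
  have large: "\<forall>\<^sub>F n in sequentially. norm (v (k n)) > B" for B
  proof -
    have "\<forall>\<^sub>F n in sequentially. real n > B"
      using filterlim_real_sequentially by (simp add: filterlim_at_top_dense)
    then show ?thesis
    proof (rule eventually_mono)
      fix n assume "real n > B"
      moreover have "real n \<le> real (k n)" using seq_suble[OF k(1)] by simp
      ultimately show "norm (v (k n)) > B" using v[of "k n"] by linarith
    qed
  qed
  have "a + c *s u \<in> closure \<Omega>" for c
  proof (rule local_Hausdorff_limit_in_closure)
    show "local_Hausdorff_converges (\<Omega>s \<circ> k) \<Omega>"
      using local_Hausdorff_converges_subseq[OF assms(1) k(1)] .
    show "(\<lambda>n. z (k n) + c *s sgn (v (k n))) \<longlonglongrightarrow> a + c *s u"
      by (intro tendsto_add za tendsto_smult vu)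
    show "\<forall>\<^sub>F n in sequentially. z (k n) + c *s sgn (v (k n)) \<in> closure ((\<Omega>s \<circ> k) n)"
      using large[of "norm c"]
    proof (rule eventually_mono)
      fix n assume *: "norm (v (k n)) > norm c"
      \<comment> \<open>Rescales \<open>c\<close> so that
        \<open>e *s v (k n) = c *s sgn (v (k n))\<close>; it lies in the unit disc once the radius
        exceeds \<open>norm c\<close>.\<close>
      define e where "e = c * of_real (inverse (norm (v (k n))))"
      have "norm e = norm c / norm (v (k n))"
        by (simp add: e_def norm_mult norm_inverse divide_inverse)
      then have "norm e < 1"
        using * le_less_trans[OF norm_ge_zero *] by simp
      then have "z (k n) + e *s v (k n) \<in> \<Omega>s (k n)"
        using disc[of "k n"] by (simp add: complex_disc_subset_iff)
      then show "z (k n) + c *s sgn (v (k n)) \<in> closure ((\<Omega>s \<circ> k) n)"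
        using closure_subset by (auto simp: e_def sgn_div_norm scaleR_eq_smult vector_smult_assoc)
    qed
  qed
  then have "u = 0" using C_properly_convex_no_line_in_closure[OF assms(2)] by blast
  moreover have "\<forall>\<^sub>F n in sequentially. norm (sgn (v (k n))) = 1"
    using large[of 0] by (rule eventually_mono) (auto simp: norm_sgn)
  then have "(\<lambda>n. norm (sgn (v (k n)))) \<longlonglongrightarrow> 1"
    by (rule tendsto_eventually)
  then have "norm u = 1" using tendsto_norm[OF vu] LIMSEQ_unique by blast
  ultimately show False by simp
qed

text \<open>A violating sequence has a convergent subsequence of domains; since
  \<open>k n \<ge> n\<close>, its discs still outgrow \<open>n\<close>, which a convergent sequence
  does not allow.\<close>

lemma compactin_complex_disc_bounded:
  fixes \<K> :: "(complex ^ 'd) set set"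
  assumes "compactin local_Hausdorff_topology \<K>"
  obtains C where "C > 0"
    "\<And>\<Omega> z v. \<Omega> \<in> \<K> \<Longrightarrow> norm z \<le> M \<Longrightarrow> complex_disc z v \<subseteq> \<Omega> \<Longrightarrow> norm v \<le> C"
proof -
  have "\<exists>n::nat. \<forall>\<Omega> z v. \<Omega> \<in> \<K> \<longrightarrow> norm z \<le> M \<longrightarrow> complex_disc z v \<subseteq> \<Omega> \<longrightarrow> norm v \<le> real n"
  proof (rule ccontr)
    assume "\<not> ?thesis"
    then have "\<forall>n::nat. \<exists>\<Omega> z v. \<Omega> \<in> \<K> \<and> norm z \<le> M \<and> complex_disc z v \<subseteq> \<Omega> \<and> norm v > real n"
      by (meson not_le)
    then obtain \<Omega>s z v where *: "\<And>n. \<Omega>s n \<in> \<K>" "\<And>n. norm (z n) \<le> M"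
      "\<And>n. complex_disc (z n) (v n) \<subseteq> \<Omega>s n" "\<And>n. norm (v n) > real n"
      by metis
    obtain k \<Omega> where k: "strict_mono (k :: nat \<Rightarrow> nat)" "\<Omega> \<in> C_properly_convex_domains"
      "local_Hausdorff_converges (\<Omega>s \<circ> k) \<Omega>"
      by (rule compactin_local_Hausdorff_convergent_subseq[OF assms *(1)])
    obtain n where "norm (v (k n)) < real n"
      using local_Hausdorff_complex_disc_bounded[OF k(3,2), of "z \<circ> k" M "v \<circ> k"] * by auto
    moreover have "real n \<le> real (k n)" using seq_suble[OF k(1)] by simp
    ultimately show False using *(4)[of "k n"] by linarith
  qed
  then obtain n :: nat where "\<And>\<Omega> z v. \<Omega> \<in> \<K> \<Longrightarrow> norm z \<le> M \<Longrightarrow> complex_disc z v \<subseteq> \<Omega> \<Longrightarrow> norm v \<le> real n"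
    by blast
  then show thesis
    by (intro that[of "real n + 1"]) force+
qed

text \<open>An interior ball of the limit persists along a convergent subsequence. One integer
  \<open>n\<close> bounds the centre and, through a reciprocal, the radius, so that failure for all
  \<open>n\<close> yields a single sequence.\<close>

lemma compactin_uniform_inner_ball:
  fixes \<K> :: "(complex ^ 'd) set set"
  assumes "compactin local_Hausdorff_topology \<K>"
  obtains M r where "r > 0" "\<And>\<Omega>. \<Omega> \<in> \<K> \<Longrightarrow> \<exists>x. norm x \<le> M \<and> ball x r \<subseteq> \<Omega>"
proof -
  have KX: "\<K> \<subseteq> C_properly_convex_domains"
    using compactin_subset_topspace[OF assms] by (simp add: topspace_local_Hausdorff_topology)
  have "\<exists>n::nat. \<forall>\<Omega>\<in>\<K>. \<exists>x. norm x \<le> real n \<and> ball x (inverse (real (Suc n))) \<subseteq> \<Omega>"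
  proof (rule ccontr)
    assume "\<not> ?thesis"
    then obtain \<Omega>s where \<Omega>s: "\<And>n. \<Omega>s n \<in> \<K>"
      "\<And>n x. norm x \<le> real n \<Longrightarrow> \<not> ball x (inverse (real (Suc n))) \<subseteq> \<Omega>s n"
      by metis
    obtain k \<Omega> where k: "strict_mono (k :: nat \<Rightarrow> nat)" "\<Omega> \<in> C_properly_convex_domains"
      "local_Hausdorff_converges (\<Omega>s \<circ> k) \<Omega>"
      by (rule compactin_local_Hausdorff_convergent_subseq[OF assms \<Omega>s(1)])
    then obtain x where x: "x \<in> \<Omega>" "open \<Omega>" by (auto simp: C_properly_convex_domains_def)
    have oc: "open ((\<Omega>s \<circ> k) n)" "convex ((\<Omega>s \<circ> k) n)" for n
      using \<Omega>s(1)[of "k n"] KX by (auto simp: C_properly_convex_domains_def)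
    obtain r where r: "r > 0" "\<forall>\<^sub>F n in sequentially. ball x r \<subseteq> (\<Omega>s \<circ> k) n"
      using local_Hausdorff_eventually_ball_subset[OF k(3) oc x(2,1)] by blast
    note r(2)
    moreover have "\<forall>\<^sub>F n in sequentially. inverse (real (Suc n)) < r"
      using order_tendstoD(2)[OF LIMSEQ_inverse_real_of_nat r(1)] .
    moreover have "\<forall>\<^sub>F n in sequentially. real n > norm x"
      using filterlim_real_sequentially by (simp add: filterlim_at_top_dense)
    ultimately have "\<forall>\<^sub>F n in sequentially.
        ball x r \<subseteq> \<Omega>s (k n) \<and> inverse (real (Suc n)) < r \<and> real n > norm x"
      by eventually_elim simp
    then obtain n where n: "ball x r \<subseteq> \<Omega>s (k n)" "inverse (real (Suc n)) < r" "real n > norm x"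
      using eventually_happens'[OF sequentially_bot] by blast
    have "n \<le> k n" using seq_suble[OF k(1)] .
    then have "inverse (real (Suc (k n))) \<le> inverse (real (Suc n))"
      by (intro le_imp_inverse_le) auto
    then have "ball x (inverse (real (Suc (k n)))) \<subseteq> \<Omega>s (k n)"
      using n by (intro order.trans[OF subset_ball n(1)]) linarith
    moreover have "norm x \<le> real (k n)" using n \<open>n \<le> k n\<close> by linarith
    ultimately show False using \<Omega>s(2) by blast
  qed
  then obtain n :: nat where "\<forall>\<Omega>\<in>\<K>. \<exists>x. norm x \<le> real n \<and> ball x (inverse (real (Suc n))) \<subseteq> \<Omega>"
    by blast
  then show thesis by (intro that[of "inverse (real (Suc n))" "real n"]) auto
qed

section \<open>Affine normalization\<close>

text \<open>Triangle inequality in the Leibniz formula; it makes the determinants of matrices of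
  disc directions bounded, so that their supremum can be taken.\<close>

lemma norm_det_le:
  fixes W :: "complex ^ 'd ^ 'd"
  assumes "\<And>i j. norm (W $ i $ j) \<le> C"
  shows "norm (det W) \<le> (\<Sum>p | p permutes (UNIV :: 'd set). C ^ CARD('d))"
  unfolding det_def
proof (rule sum_norm_le)
  fix p assume "p \<in> {p. p permutes (UNIV :: 'd set)}"
  have "norm (of_int (sign p) * (\<Prod>i\<in>UNIV. W $ i $ p i)) = (\<Prod>i\<in>UNIV. norm (W $ i $ p i))"
    by (simp add: norm_mult prod_norm sign_def)
  also have "\<dots> \<le> (\<Prod>i\<in>(UNIV :: 'd set). C)"
    using assms by (intro prod_mono) auto
  finally show "norm (of_int (sign p) * (\<Prod>i\<in>UNIV. W $ i $ p i)) \<le> C ^ CARD('d)" by simp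
qed

lemma C_properly_convex_complex_disc_bounded:
  fixes \<Omega> :: "(complex ^ 'd) set"
  assumes "\<Omega> \<in> C_properly_convex_domains"
  obtains C where "\<And>v. complex_disc p v \<subseteq> \<Omega> \<Longrightarrow> norm v \<le> C"
proof -
  have "\<exists>n::nat. \<forall>v. complex_disc p v \<subseteq> \<Omega> \<longrightarrow> norm v \<le> real n"
  proof (rule ccontr)
    assume "\<not> ?thesis"
    then obtain v where "\<And>n::nat. complex_disc p (v n) \<subseteq> \<Omega>" "\<And>n. norm (v n) > real n"
      by (metis not_le)
    then show False
      using local_Hausdorff_complex_disc_bounded[OF local_Hausdorff_converges_const assms, of "\<lambda>_. p" "norm p" v]
      by (meson less_asym order_refl)
  qed
  then show thesis using that by blast
qed

lemma continuous_on_matrix_vector_mult: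
  fixes W :: "complex ^ 'd ^ 'd"
  shows "continuous_on S (\<lambda>x. W *v x)"
  unfolding matrix_vector_mult_def
  by (intro continuous_intros)

lemma matrix_vector_mult_scaleR:
  fixes W :: "complex ^ 'd ^ 'd"
  shows "W *v (t *\<^sub>R x) = t *\<^sub>R (W *v x)"
  by (simp only: scaleR_eq_smult vector_scalar_commute)

text \<open>Take \<open>W\<close> with \<open>\<bar>det W\<bar>\<close> within a factor \<open>2\<close> of the supremum over all matrices whose columns span
  discs at \<open>p\<close>. Replacing a column by another disc direction multiplies the determinant by at most
  \<open>2\<close>, which by Cramer's rule bounds the coordinates.\<close>

lemma almost_maximal_disc_basis:
  fixes \<Omega> :: "(complex ^ 'd) set"
  assumes "\<Omega> \<in> C_properly_convex_domains" "p \<in> \<Omega>"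
  obtains W :: "complex ^ 'd ^ 'd" where "det W \<noteq> 0" "\<And>j. complex_disc p (column j W) \<subseteq> \<Omega>"
    "\<And>x k. complex_disc p (W *v x) \<subseteq> \<Omega> \<Longrightarrow> norm (x $ k) \<le> 2"
proof -
  define Adm where "Adm = {W :: complex ^ 'd ^ 'd. \<forall>j. complex_disc p (column j W) \<subseteq> \<Omega>}"
  define S where "S = (\<lambda>W. norm (det W)) ` Adm"
  have "open \<Omega>" using assms by (auto simp: C_properly_convex_domains_def)
  obtain C where C: "\<And>v. complex_disc p v \<subseteq> \<Omega> \<Longrightarrow> norm v \<le> C"
    using C_properly_convex_complex_disc_bounded[OF assms(1)] by blast
  have bdd: "bdd_above S"
    unfolding S_def
  proof (rule bdd_aboveI2)
    fix W assume "W \<in> Adm"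
    have "norm (W $ i $ j) \<le> C" for i j
    proof -
      have "norm (W $ i $ j) \<le> norm (column j W)"
        using Finite_Cartesian_Product.norm_nth_le[of "column j W" i] by (simp add: column_def)
      also have "\<dots> \<le> C" using C \<open>W \<in> Adm\<close> by (auto simp: Adm_def)
      finally show ?thesis .
    qed
    then show "norm (det W) \<le> (\<Sum>p | p permutes (UNIV :: 'd set). C ^ CARD('d))"
      by (rule norm_det_le)
  qed
  obtain \<rho> where \<rho>: "\<rho> > 0" "ball p \<rho> \<subseteq> \<Omega>"
    using \<open>open \<Omega>\<close> assms(2) open_contains_ball by blast
  \<comment> \<open>A scalar matrix whose columns fit into the ball about \<open>p\<close>; its
    determinant shows that the supremum is positive.\<close>
  define E :: "complex ^ 'd ^ 'd" where "E = (\<chi> i j. if i = j then of_real \<rho> else 0)"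
  have "norm (column j E) = \<rho>" for j
  proof -
    have "column j E = of_real \<rho> *s axis j 1"
      by (simp add: column_def E_def axis_def vec_eq_iff)
    then show ?thesis using \<rho> by (simp add: norm_smult)
  qed
  then have "E \<in> Adm"
    using complex_disc_subset_ball[OF _ \<rho>(1)] \<rho>(2) by (force simp: Adm_def)
  have "det E = of_real \<rho> ^ CARD('d)"
    by (subst det_diagonal) (auto simp: E_def)
  then have "norm (det E) > 0" using \<rho> by simp
  moreover have "norm (det E) \<le> Sup S"
    using \<open>E \<in> Adm\<close> bdd by (intro cSup_upper) (auto simp: S_def)
  ultimately have Sup_pos: "Sup S > 0" by linarith
  then have "\<exists>s\<in>S. Sup S / 2 < s"
    using \<open>E \<in> Adm\<close> by (intro less_cSupD) (auto simp: S_def)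
  then obtain W where W: "W \<in> Adm" "Sup S / 2 < norm (det W)" by (auto simp: S_def)
  then have det: "det W \<noteq> 0" using Sup_pos by auto
  moreover have "norm (x $ k) \<le> 2" if x: "complex_disc p (W *v x) \<subseteq> \<Omega>" for x k
  proof -
    define Wk :: "complex ^ 'd ^ 'd" where "Wk = (\<chi> i j. if j = k then (W *v x) $ i else W $ i $ j)"
    have "column j Wk = (if j = k then W *v x else column j W)" for j
      by (simp add: column_def Wk_def vec_eq_iff)
    then have "Wk \<in> Adm" using W(1) x by (auto simp: Adm_def)
    then have "norm (det Wk) \<le> Sup S" using bdd by (auto simp: S_def intro!: cSup_upper)
    moreover have "det Wk = x $ k * det W" unfolding Wk_def by (rule cramer_lemma)
    ultimately have "norm (x $ k) * norm (det W) \<le> 2 * norm (det W)"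
      using W(2) by (simp add: norm_mult)
    then show ?thesis using det by simp
  qed
  ultimately show thesis using that W(1) by (auto simp: Adm_def)
qed

text \<open>\<open>A\<close> inverts \<open>x \<mapsto> p + W x\<close> for an almost maximal system
  of discs \<open>W\<close>. The image contains the unit discs along the coordinate axes and hence,
  by convexity, a ball; the coordinate bound 2 controls discs at the origin.\<close>

lemma affine_normalization:
  fixes \<Omega> :: "(complex ^ 'd) set"
  assumes "\<Omega> \<in> C_properly_convex_domains" "p \<in> \<Omega>"
  obtains V :: "complex ^ 'd ^ 'd" and A where "A = (\<lambda>x. V *v (x - p))"
    "A \<in> complex_affine_group" "\<And>x. A x \<in> A ` \<Omega> \<longleftrightarrow> x \<in> \<Omega>" "open (A ` \<Omega>)" "convex (A ` \<Omega>)"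
    "ball 0 (1 / real CARD('d)) \<subseteq> A ` \<Omega>"
    "\<And>v. complex_disc 0 v \<subseteq> A ` \<Omega> \<Longrightarrow> norm v \<le> 2 * real CARD('d)"
proof -
  have \<Omega>: "open \<Omega>" "convex \<Omega>" using assms by (auto simp: C_properly_convex_domains_def)
  obtain W :: "complex ^ 'd ^ 'd" where W: "det W \<noteq> 0" "\<And>j. complex_disc p (column j W) \<subseteq> \<Omega>"
    "\<And>x k. complex_disc p (W *v x) \<subseteq> \<Omega> \<Longrightarrow> norm (x $ k) \<le> 2"
    using almost_maximal_disc_basis[OF assms] by blast
  then obtain V where V: "W ** V = mat 1" "V ** W = mat 1"
    by (auto simp: invertible_det_nz[symmetric] invertible_def)
  define A where "A = (\<lambda>x. V *v (x - p))"
  have WA: "p + W *v A x = x" for x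
    by (simp add: A_def matrix_vector_mul_assoc V)
  have AW: "A (p + W *v x) = x" for x
    by (simp add: A_def matrix_vector_mul_assoc V)
  have image: "A ` \<Omega> = {x. p + W *v x \<in> \<Omega>}"
  proof (intro equalityI subsetI)
    fix x assume "x \<in> {x. p + W *v x \<in> \<Omega>}"
    then show "x \<in> A ` \<Omega>" using AW[of x] by (metis imageI mem_Collect_eq)
  qed (auto simp: WA)
  have "A = (\<lambda>x. V *v x + V *v (- p))"
    by (auto simp: A_def matrix_vector_right_distrib[symmetric])
  moreover have "invertible V" using V by (auto simp: invertible_def)
  ultimately have "A \<in> complex_affine_group"
    unfolding complex_affine_group_def by blast
  moreover have "A x \<in> A ` \<Omega> \<longleftrightarrow> x \<in> \<Omega>" for x
    by (simp add: image WA)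
  moreover have "open (A ` \<Omega>)"
  proof -
    have "continuous_on UNIV (\<lambda>x. p + W *v x)"
      by (intro continuous_intros continuous_on_matrix_vector_mult)
    then have "open ((\<lambda>x. p + W *v x) -` \<Omega>)" using open_vimage[OF \<Omega>(1)] by blast
    then show ?thesis by (simp add: image vimage_def)
  qed
  moreover have "convex (A ` \<Omega>)"
  proof (rule convexI)
    fix x y and s t :: real
    assume *: "x \<in> A ` \<Omega>" "y \<in> A ` \<Omega>" "0 \<le> s" "0 \<le> t" "s + t = 1"
    have "s *\<^sub>R (p + W *v x) + t *\<^sub>R (p + W *v y) \<in> \<Omega>"
      using * by (intro convexD[OF \<Omega>(2)]) (auto simp: image WA)
    moreover have "s *\<^sub>R p + t *\<^sub>R p = p"
      using * by (simp add: scaleR_add_left[symmetric])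
    then have "s *\<^sub>R (p + W *v x) + t *\<^sub>R (p + W *v y) = p + W *v (s *\<^sub>R x + t *\<^sub>R y)"
      by (simp add: matrix_vector_right_distrib matrix_vector_mult_scaleR scaleR_add_right algebra_simps)
    ultimately show "s *\<^sub>R x + t *\<^sub>R y \<in> A ` \<Omega>" by (simp add: image)
  qed
  moreover have "ball 0 (1 / real CARD('d)) \<subseteq> A ` \<Omega>"
  proof
    fix x :: "complex ^ 'd" assume x: "x \<in> ball 0 (1 / real CARD('d))"
    let ?d = "real CARD('d)"
    have d: "?d > 0" by simp
    \<comment> \<open>\<open>p + W x\<close> is the average of one point on each disc. The factor
      \<open>?d\<close> on the coordinates compensates the weights, and the parameters stay below 1
      in modulus because \<open>norm x < 1 / ?d\<close>.\<close>
    have "(\<Sum>j\<in>UNIV. (1 / ?d) *\<^sub>R (p + (of_real ?d * x $ j) *s column j W)) \<in> \<Omega>"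
    proof (rule convex_sum)
      fix j :: 'd
      have "norm (x $ j) < 1 / ?d" using Finite_Cartesian_Product.norm_nth_le[of x j] x by simp
      then have "norm (of_real ?d * x $ j) < 1"
        using d by (simp add: norm_mult field_simps)
      then show "p + (of_real ?d * x $ j) *s column j W \<in> \<Omega>"
        using W(2)[of j] unfolding complex_disc_subset_iff by blast
    qed (use \<Omega> in auto)
    also have "(\<Sum>j\<in>UNIV. (1 / ?d) *\<^sub>R (p + (of_real ?d * x $ j) *s column j W))
        = (\<Sum>j\<in>(UNIV :: 'd set). (1 / ?d) *\<^sub>R p) + (\<Sum>j\<in>UNIV. x $ j *s column j W)"
      unfolding sum.distrib[symmetric]
      by (intro sum.cong) (auto simp: scaleR_add_right scaleR_eq_smult vector_smult_assoc)
    also have "\<dots> = p + W *v x"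
      by (simp add: matrix_mult_sum sum_constant_scaleR del: sum_constant)
    finally show "x \<in> A ` \<Omega>" by (simp add: image)
  qed
  moreover have "norm v \<le> 2 * real CARD('d)" if "complex_disc 0 v \<subseteq> A ` \<Omega>" for v
  proof -
    have "complex_disc p (W *v v) \<subseteq> \<Omega>"
      using that by (simp add: complex_disc_subset_iff image vector_scalar_commute)
    then have "norm (v $ k) \<le> 2" for k by (rule W(3))
    then have "(\<Sum>k\<in>UNIV. norm (v $ k)) \<le> (\<Sum>k\<in>(UNIV :: 'd set). 2)" by (intro sum_mono)
    moreover have "norm v \<le> (\<Sum>k\<in>UNIV. norm (v $ k))"
      unfolding norm_vec_def by (rule L2_set_le_sum) auto
    ultimately show ?thesis by simp
  qed
  ultimately show thesis using that[OF A_def] by blast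
qed

section \<open>The doubling property\<close>

text \<open>The points \<open>q n\<close> outside the domains force their limit \<open>a\<close> out
  of \<open>D\<close>, while the discs converge to a disc about \<open>a\<close> in
  \<open>closure D\<close>. By convexity this disc avoids \<open>D\<close>, hence lies in the
  frontier, and simplicity reduces it to a point.\<close>

lemma simple_boundary_disc_limit:
  fixes Ds :: "nat \<Rightarrow> (complex ^ 'd) set"
  assumes Ds: "\<And>n. open (Ds n)" "\<And>n. convex (Ds n)"
    and D: "local_Hausdorff_converges Ds D" "D \<in> C_properly_convex_domains" "simple_boundary D"
    and q: "\<And>n. q n \<notin> Ds n" "q \<longlonglongrightarrow> a" "(\<lambda>n. y n - q n) \<longlonglongrightarrow> 0"
    and disc: "\<And>n. complex_disc (y n) (u n) \<subseteq> Ds n" "u \<longlonglongrightarrow> l"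
  shows "l = 0"
proof -
  have "open D" "convex D" using D by (auto simp: C_properly_convex_domains_def)
  have "y \<longlonglongrightarrow> a"
    using tendsto_add[OF q(3,2)] by simp
  have cl: "a + c *s l \<in> closure D" if "norm c < 1" for c
  proof (rule local_Hausdorff_limit_in_closure[OF D(1)])
    show "(\<lambda>n. y n + c *s u n) \<longlonglongrightarrow> a + c *s l"
      by (intro tendsto_add tendsto_smult \<open>y \<longlonglongrightarrow> a\<close> disc)
    have "y n + c *s u n \<in> closure (Ds n)" for n
      using disc(1)[of n] that closure_subset unfolding complex_disc_subset_iff by blast
    then show "\<forall>\<^sub>F n in sequentially. y n + c *s u n \<in> closure (Ds n)" by simp
  qed
  have "a \<notin> D"
  proof
    assume "a \<in> D"
    obtain r where r: "r > 0" "\<forall>\<^sub>F n in sequentially. ball a r \<subseteq> Ds n"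
      by (rule local_Hausdorff_eventually_ball_subset[OF D(1) Ds \<open>open D\<close> \<open>a \<in> D\<close>])
    have "\<forall>\<^sub>F n in sequentially. q n \<in> ball a r"
      using tendstoD[OF q(2) r(1)] by (simp add: dist_commute)
    then have "\<forall>\<^sub>F n in sequentially. q n \<in> Ds n"
      using r(2) by eventually_elim blast
    then show False using q(1) by simp
  qed
  have fr: "a + c *s l \<in> frontier D" if c: "norm c < 1" for c
  proof -
    have "a + c *s l \<notin> D"
    proof
      assume "a + c *s l \<in> D"
      \<comment> \<open>\<open>a\<close> is the midpoint of two opposite points of the disc. With
        one of them in \<open>D\<close> and the other in the closure, \<open>a\<close> would be
        interior.\<close>
      then have "(a + (- c) *s l) - (1/2) *\<^sub>R ((a + (- c) *s l) - (a + c *s l)) \<in> interior D"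
        using \<open>open D\<close> \<open>convex D\<close> cl[of "- c"] c
        by (intro mem_interior_closure_convex_shrink) (auto simp: interior_open)
      moreover have "(a + (- c) *s l) - (1/2) *\<^sub>R ((a + (- c) *s l) - (a + c *s l)) = a"
        unfolding scaleR_eq_smult vec_eq_iff by (simp add: field_simps)
      ultimately show False using \<open>a \<notin> D\<close> interior_subset by (metis subsetD)
    qed
    then show ?thesis using cl[OF c] \<open>open D\<close> by (simp add: frontier_def interior_open)
  qed
  define f where "f \<zeta> = a + \<zeta> *s l" for \<zeta>
  have "(\<lambda>\<zeta>. f \<zeta> $ i) holomorphic_on ball 0 1" for i
    unfolding f_def vector_add_component vector_smult_component by (intro holomorphic_intros)
  moreover have "f ` ball 0 1 \<subseteq> frontier D" using fr by (auto simp: f_def)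
  ultimately have "f constant_on ball 0 1" using D(3) unfolding simple_boundary_def by blast
  then have "f (1/2) = f 0" unfolding constant_on_def by auto
  then show ?thesis by (simp add: f_def vec_eq_iff)
qed

text \<open>The homothety with centre \<open>z\<close> and ratio \<open>\<sigma>\<close> maps
  \<open>ball x r\<close> onto the smaller ball, and convexity keeps the image in
  \<open>\<Omega>\<close>.\<close>

lemma ball_subset_convex_shrink:
  fixes x z :: "'a::real_normed_vector"
  assumes "convex \<Omega>" "z \<in> \<Omega>" "ball x r \<subseteq> \<Omega>" "0 < \<sigma>" "\<sigma> \<le> 1"
  shows "ball (z + \<sigma> *\<^sub>R (x - z)) (\<sigma> * r) \<subseteq> \<Omega>"
proof
  let ?p = "z + \<sigma> *\<^sub>R (x - z)"
  fix y assume y: "y \<in> ball ?p (\<sigma> * r)"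
  define w where "w = y - ?p"
  have "norm w < \<sigma> * r" using y by (simp add: w_def dist_norm norm_minus_commute)
  then have "norm ((1 / \<sigma>) *\<^sub>R w) < r" using assms(4) by (simp add: field_simps)
  then have "x + (1 / \<sigma>) *\<^sub>R w \<in> \<Omega>"
    by (intro subsetD[OF assms(3)]) (simp add: dist_norm)
  then have "(1 - \<sigma>) *\<^sub>R z + \<sigma> *\<^sub>R (x + (1 / \<sigma>) *\<^sub>R w) \<in> \<Omega>"
    using assms by (intro convexD) auto
  moreover have "(1 - \<sigma>) *\<^sub>R z + \<sigma> *\<^sub>R (x + (1 / \<sigma>) *\<^sub>R w) = ?p + w"
    using assms(4) by (simp add: algebra_simps)
  ultimately show "y \<in> \<Omega>" by (simp add: w_def)
qed

text \<open>Normalize at \<open>p = z + N s (x - z)\<close>, where a ball of radius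
  \<open>N s r\<close> fits. The map expands by at most a multiple of \<open>1 / (N s)\<close>, so
  the image of \<open>\<xi>\<close> stays bounded and that of the point with parameter
  \<open>s\<close> is within order \<open>1 / N\<close> of it. Failure of doubling keeps the image
  of the disc from degenerating.\<close>

lemma failed_doubling_rescaling:
  fixes \<Omega> :: "(complex ^ 'd) set" and M R N r s :: real
  assumes \<Omega>: "\<Omega> \<in> C_properly_convex_domains" "z \<in> \<Omega>" "norm z \<le> R"
    and x: "norm x \<le> M" "ball x r \<subseteq> \<Omega>" "r > 0"
    and \<xi>: "\<xi> \<notin> \<Omega>" "dist z \<xi> \<le> s" and s: "0 < s" "1 \<le> N" "N * s \<le> 1"
    and disc: "complex_disc (z + s *\<^sub>R (x - z)) v \<subseteq> \<Omega>"
    and not_disc: "\<not> complex_disc (z + (N * s) *\<^sub>R (x - z)) (2 *\<^sub>R v) \<subseteq> \<Omega>"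
  defines "L \<equiv> 2 * real CARD('d) * (M + R + 1) / r"
  obtains A q y u where "A \<in> complex_affine_group" "open (A ` \<Omega>)" "convex (A ` \<Omega>)"
    "ball 0 (1 / real CARD('d)) \<subseteq> A ` \<Omega>"
    "\<And>v. complex_disc 0 v \<subseteq> A ` \<Omega> \<Longrightarrow> norm v \<le> 2 * real CARD('d)"
    "q \<notin> A ` \<Omega>" "norm q \<le> L" "norm (y - q) \<le> L / N"
    "norm u = 1 / (2 * real CARD('d))" "complex_disc y u \<subseteq> A ` \<Omega>"
proof -
  have "convex \<Omega>" using \<Omega> by (auto simp: C_properly_convex_domains_def)
  define \<sigma> where "\<sigma> = N * s"
  have \<sigma>: "0 < \<sigma>" "\<sigma> \<le> 1" "s \<le> \<sigma>" using s by (auto simp: \<sigma>_def)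
  define p where "p = z + \<sigma> *\<^sub>R (x - z)"
  have ball_p: "ball p (\<sigma> * r) \<subseteq> \<Omega>"
    unfolding p_def by (rule ball_subset_convex_shrink[OF \<open>convex \<Omega>\<close> \<Omega>(2) x(2) \<sigma>(1,2)])
  have "\<sigma> * r > 0" using \<sigma> x by simp
  then have "p \<in> \<Omega>" using ball_p by (metis centre_in_ball subsetD)
  obtain V :: "complex ^ 'd ^ 'd" and A where A: "A = (\<lambda>x. V *v (x - p))"
    "A \<in> complex_affine_group" "\<And>x. A x \<in> A ` \<Omega> \<longleftrightarrow> x \<in> \<Omega>" "open (A ` \<Omega>)" "convex (A ` \<Omega>)"
    "ball 0 (1 / real CARD('d)) \<subseteq> A ` \<Omega>"
    "\<And>v. complex_disc 0 v \<subseteq> A ` \<Omega> \<Longrightarrow> norm v \<le> 2 * real CARD('d)"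
    by (rule affine_normalization[OF \<Omega>(1) \<open>p \<in> \<Omega>\<close>]) (rule that)
  have "A p = 0" by (simp add: A(1))
  have A_line: "A (a + c *s w) = A a + c *s (V *v w)" for a c w
  proof -
    have "a + c *s w - p = (a - p) + c *s w" by simp
    then show ?thesis
      unfolding A(1) by (simp only: matrix_vector_right_distrib vector_scalar_commute)
  qed
  have A_disc: "complex_disc (A a) (V *v w) \<subseteq> A ` \<Omega> \<longleftrightarrow> complex_disc a w \<subseteq> \<Omega>" for a w
    unfolding complex_disc_subset_iff A_line[symmetric] A(3) ..
  \<comment> \<open>A vector of length \<open>\<sigma> * r\<close> spans a disc at \<open>p\<close>
    inside \<open>\<Omega>\<close>, so the bound on discs in the normalized domain acts as an
    operator norm bound for \<open>V\<close>.\<close>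
  have V_bound: "norm (V *v w) * (\<sigma> * r) \<le> 2 * real CARD('d) * norm w" for w
  proof (cases "w = 0")
    case False
    define w' where "w' = (\<sigma> * r / norm w) *\<^sub>R w"
    have "norm w' = \<sigma> * r" using False \<open>\<sigma> * r > 0\<close> by (simp add: w'_def)
    then have "complex_disc p w' \<subseteq> \<Omega>"
      using complex_disc_subset_ball[of w' "\<sigma> * r" p] \<open>\<sigma> * r > 0\<close> ball_p by simp
    then have "complex_disc 0 (V *v w') \<subseteq> A ` \<Omega>"
      using A_disc[of p w'] \<open>A p = 0\<close> by simp
    then have "norm (V *v w') \<le> 2 * real CARD('d)" by (rule A(7))
    moreover have "norm (V *v w') = \<sigma> * r / norm w * norm (V *v w)"
      using \<open>\<sigma> * r > 0\<close> by (simp add: w'_def matrix_vector_mult_scaleR)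
    ultimately show ?thesis using False by (simp add: field_simps)
  qed simp
  define y where "y = A (z + s *\<^sub>R (x - z))"
  have xz: "norm (x - z) \<le> M + R"
    using norm_triangle_ineq4[of x z] x \<Omega> by linarith
  have \<xi>z: "norm (\<xi> - z) \<le> s" using \<xi> by (simp add: dist_norm norm_minus_commute)
  \<comment> \<open>\<open>\<xi>\<close> is within \<open>s \<le> \<sigma>\<close> of
    \<open>z\<close>, and \<open>z\<close> within \<open>\<sigma> * (M + R)\<close> of
    \<open>p\<close>; the factor \<open>\<sigma>\<close> cancels.\<close>
  have "norm (A \<xi>) \<le> L"
  proof -
    have "norm (\<xi> - p) \<le> norm (\<xi> - z) + norm (\<sigma> *\<^sub>R (x - z))"
      unfolding p_def using norm_triangle_ineq4[of "\<xi> - z" "\<sigma> *\<^sub>R (x - z)"] by (simp add: algebra_simps)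
    also have "\<dots> \<le> \<sigma> + \<sigma> * (M + R)"
      using \<xi>z \<sigma>(3) mult_left_mono[OF xz less_imp_le[OF \<sigma>(1)]]
      unfolding norm_scaleR abs_of_pos[OF \<sigma>(1)] by linarith
    finally have "norm (\<xi> - p) \<le> \<sigma> * (M + R + 1)" by (simp add: algebra_simps)
    then have "norm (V *v (\<xi> - p)) * (\<sigma> * r) \<le> 2 * real CARD('d) * (\<sigma> * (M + R + 1))"
      by (intro order_trans[OF V_bound] mult_left_mono) auto
    then have "norm (V *v (\<xi> - p)) * r * \<sigma> \<le> 2 * real CARD('d) * (M + R + 1) * \<sigma>"
      by (simp add: mult_ac)
    then have "norm (V *v (\<xi> - p)) * r \<le> 2 * real CARD('d) * (M + R + 1)"
      using \<sigma>(1) by (rule mult_right_le_imp_le)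
    then show ?thesis using x(3) by (simp add: A(1) L_def pos_le_divide_eq)
  qed
  \<comment> \<open>Here the distance before normalization is of order
    \<open>s = \<sigma> / N\<close>, which produces the gain \<open>1 / N\<close>.\<close>
  moreover have "norm (y - A \<xi>) \<le> L / N"
  proof -
    let ?w = "z + s *\<^sub>R (x - z)"
    have "norm (?w - \<xi>) \<le> norm (s *\<^sub>R (x - z)) + norm (\<xi> - z)"
      using norm_triangle_ineq4[of "s *\<^sub>R (x - z)" "\<xi> - z"] by (simp add: algebra_simps)
    also have "\<dots> \<le> s * (M + R) + s"
      using \<xi>z mult_left_mono[OF xz less_imp_le[OF s(1)]]
      unfolding norm_scaleR abs_of_pos[OF s(1)] by linarith
    finally have "norm (?w - \<xi>) \<le> s * (M + R + 1)" by (simp add: algebra_simps)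
    then have "norm (V *v (?w - \<xi>)) * (\<sigma> * r) \<le> 2 * real CARD('d) * (s * (M + R + 1))"
      by (intro order_trans[OF V_bound] mult_left_mono) auto
    then have "norm (V *v (?w - \<xi>)) * (N * r) * s \<le> 2 * real CARD('d) * (M + R + 1) * s"
      by (simp add: \<sigma>_def mult_ac)
    then have "norm (V *v (?w - \<xi>)) * (N * r) \<le> 2 * real CARD('d) * (M + R + 1)"
      using s(1) by (rule mult_right_le_imp_le)
    moreover have "y - A \<xi> = V *v (?w - \<xi>)"
      by (simp add: y_def A(1) matrix_vector_mult_diff_distrib)
    ultimately show ?thesis using s x(3) by (simp add: L_def pos_le_divide_eq mult_ac)
  qed
  moreover have "A \<xi> \<notin> A ` \<Omega>" using \<xi>(1) A(3) by blast
  moreover obtain u where "norm u = 1 / (2 * real CARD('d))" "complex_disc y u \<subseteq> A ` \<Omega>"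
  proof -
    let ?\<epsilon> = "1 / real CARD('d)"
    \<comment> \<open>If \<open>2 *\<^sub>R (V *v v)\<close> were no longer than
      \<open>?\<epsilon>\<close>, its disc would fit into the normalized ball. Hence
      \<open>V *v v\<close> is longer than \<open>?\<epsilon> / 2\<close> and can be cut to this
      length, which is independent of \<open>N\<close>.\<close>
    have "\<not> complex_disc 0 (2 *\<^sub>R (V *v v)) \<subseteq> A ` \<Omega>"
      using not_disc A_disc[of p "2 *\<^sub>R v"] \<open>A p = 0\<close> by (simp add: p_def \<sigma>_def matrix_vector_mult_scaleR)
    then have "\<not> norm (2 *\<^sub>R (V *v v)) \<le> ?\<epsilon>"
      using complex_disc_subset_ball[of "2 *\<^sub>R (V *v v)" ?\<epsilon> 0] A(6) by auto
    then have big: "norm (V *v v) > ?\<epsilon> / 2" by simp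
    define u where "u = (?\<epsilon> / 2 / norm (V *v v)) *\<^sub>R (V *v v)"
    have pos: "norm (V *v v) > 0" using big by (rule order.strict_trans[rotated]) simp
    have "\<bar>?\<epsilon> / 2 / norm (V *v v)\<bar> \<le> 1"
    proof -
      have "?\<epsilon> / 2 / norm (V *v v) \<le> 1"
        using less_imp_le[OF big] unfolding divide_le_eq_1_pos[OF pos] .
      moreover have "0 \<le> ?\<epsilon> / 2 / norm (V *v v)" by simp
      ultimately show ?thesis by linarith
    qed
    then have "complex_disc y u \<subseteq> A ` \<Omega>"
      unfolding u_def using disc A_disc[of "z + s *\<^sub>R (x - z)" v]
      by (intro complex_disc_scaleR_subset) (auto simp: y_def)
    moreover have "norm u = 1 / (2 * real CARD('d))" using pos by (simp add: u_def)
    ultimately show thesis using that by blast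
  qed
  ultimately show thesis using that[OF A(2,4,5,6,7)] by blast
qed

text \<open>Failure for every \<open>N\<close> gives normalized domains with exterior points
  \<open>q\<close>, nearby disc centres \<open>y\<close> and directions of fixed length. A
  subsequence converges to a domain in the orbit closure, whose simple boundary would force the
  limiting direction to vanish.\<close>

lemma complex_disc_doubling:
  fixes \<K> :: "(complex ^ 'd) set set"
  assumes K: "\<K> \<subseteq> C_properly_convex_domains" "\<forall>D\<in>affine_orbit_closure \<K>. simple_boundary D"
    and "r > 0"
  obtains N :: nat where "N \<ge> 2"
    "\<And>\<Omega> z x \<xi> s v. \<Omega> \<in> \<K> \<Longrightarrow> z \<in> \<Omega> \<Longrightarrow> norm z \<le> R \<Longrightarrow> norm x \<le> M \<Longrightarrow> ball x r \<subseteq> \<Omega> \<Longrightarrow>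
       \<xi> \<notin> \<Omega> \<Longrightarrow> dist z \<xi> \<le> s \<Longrightarrow> 0 < s \<Longrightarrow> real N * s \<le> 1 \<Longrightarrow>
       complex_disc (z + s *\<^sub>R (x - z)) v \<subseteq> \<Omega> \<Longrightarrow>
       complex_disc (z + (real N * s) *\<^sub>R (x - z)) (2 *\<^sub>R v) \<subseteq> \<Omega>"
proof -
  define L where "L = 2 * real CARD('d) * (M + R + 1) / r"
  \<comment> \<open>The data that a failed doubling with factor \<open>N\<close> produces; the shift
    to \<open>n + 2\<close> below builds in \<open>N \<ge> 2\<close>.\<close>
  define bad where "bad N \<Omega> A q y u \<longleftrightarrow> A \<in> complex_affine_group \<and> open (A ` \<Omega>) \<and> convex (A ` \<Omega>) \<and>
    ball 0 (1 / real CARD('d)) \<subseteq> A ` \<Omega> \<and>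
    (\<forall>v. complex_disc 0 v \<subseteq> A ` \<Omega> \<longrightarrow> norm v \<le> 2 * real CARD('d)) \<and>
    q \<notin> A ` \<Omega> \<and> norm q \<le> L \<and> norm (y - q) \<le> L / real N \<and>
    norm u = 1 / (2 * real CARD('d)) \<and> complex_disc y u \<subseteq> A ` \<Omega>"
    for N :: nat and \<Omega> :: "(complex ^ 'd) set" and A q y u
  have False if all_bad: "\<And>n::nat. \<exists>\<Omega>\<in>\<K>. \<exists>A q y u. bad (n + 2) \<Omega> A q y u"
  proof -
    obtain \<Omega>s A q y u where \<Omega>s: "\<And>n. \<Omega>s n \<in> \<K>" and b: "\<And>n. bad (n + 2) (\<Omega>s n) (A n) (q n) (y n) (u n)"
      using all_bad by metis
    define Ds where "Ds n = A n ` \<Omega>s n" for n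
    have Ds: "\<And>n. open (Ds n)" "\<And>n. convex (Ds n)" "\<And>n. ball 0 (1 / real CARD('d)) \<subseteq> Ds n"
      and bound: "\<And>n v. complex_disc 0 v \<subseteq> Ds n \<Longrightarrow> norm v \<le> 2 * real CARD('d)"
      and q: "\<And>n. q n \<notin> Ds n" "\<And>n. norm (q n) \<le> L" "\<And>n. norm (y n - q n) \<le> L / real (n + 2)"
      and u: "\<And>n. norm (u n) = 1 / (2 * real CARD('d))" "\<And>n. complex_disc (y n) (u n) \<subseteq> Ds n"
      and A: "\<And>n. A n \<in> complex_affine_group"
      using b unfolding bad_def Ds_def by blast+
    obtain k D where k: "strict_mono (k :: nat \<Rightarrow> nat)" "D \<in> C_properly_convex_domains"
      "local_Hausdorff_converges (Ds \<circ> k) D"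
      by (rule local_Hausdorff_selection[OF Ds _ bound]) auto
    \<comment> \<open>\<open>q\<close> and \<open>u\<close> are extracted together, on top of the
      subsequence \<open>k\<close>, so that all limits hold along the same \<open>m\<close>.\<close>
    have "bounded (range (\<lambda>n. (q (k n), u (k n))))"
    proof (rule boundedI)
      fix w assume "w \<in> range (\<lambda>n. (q (k n), u (k n)))"
      then obtain n where "w = (q (k n), u (k n))" by auto
      then show "norm w \<le> L + 1 / (2 * real CARD('d))"
        using norm_Pair_le[of "q (k n)" "u (k n)"] q(2)[of "k n"] u(1)[of "k n"] by simp
    qed
    then obtain l h where h: "strict_mono (h :: nat \<Rightarrow> nat)" "((\<lambda>n. (q (k n), u (k n))) \<circ> h) \<longlonglongrightarrow> l"
      using bounded_imp_convergent_subsequence by blast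
    define m where "m = k \<circ> h"
    have m: "strict_mono m" using k(1) h(1) by (simp add: m_def strict_mono_o)
    have conv: "local_Hausdorff_converges (Ds \<circ> m) D"
      using local_Hausdorff_converges_subseq[OF k(3) h(1)] by (simp add: m_def o_assoc)
    then have "D \<in> affine_orbit_closure \<K>"
      unfolding affine_orbit_closure_def using k(2) A \<Omega>s
      by (auto simp: Ds_def o_def intro!: exI[of _ "A \<circ> m"] exI[of _ "\<Omega>s \<circ> m"])
    then have "simple_boundary D" using K(2) by blast
    have lim: "(\<lambda>n. q (m n)) \<longlonglongrightarrow> fst l" "(\<lambda>n. u (m n)) \<longlonglongrightarrow> snd l"
      using tendsto_fst[OF h(2)] tendsto_snd[OF h(2)] by (auto simp: o_def m_def)
    have "(\<lambda>n. y n - q n) \<longlonglongrightarrow> 0"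
    proof (rule Lim_null_comparison)
      show "\<forall>\<^sub>F n in sequentially. norm (y n - q n) \<le> L / real (n + 2)" using q(3) by simp
      show "(\<lambda>n. L / real (n + 2)) \<longlonglongrightarrow> 0"
        using LIMSEQ_ignore_initial_segment[OF lim_const_over_n[of L], of 2] by simp
    qed
    then have "(\<lambda>n. y (m n) - q (m n)) \<longlonglongrightarrow> 0"
      using LIMSEQ_subseq_LIMSEQ[OF _ m, of "\<lambda>n. y n - q n"] by (simp add: o_def)
    then have "snd l = 0"
      using simple_boundary_disc_limit[of "Ds \<circ> m" D "\<lambda>n. q (m n)" "fst l" "\<lambda>n. y (m n)" "\<lambda>n. u (m n)" "snd l"]
        Ds q u conv k(2) \<open>simple_boundary D\<close> lim by simp
    moreover have "norm (snd l) = 1 / (2 * real CARD('d))"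
      using tendsto_norm[OF lim(2)] u(1) by (simp add: LIMSEQ_const_iff)
    ultimately show False by simp
  qed
  then obtain n :: nat where good: "\<And>\<Omega> A q y u. \<Omega> \<in> \<K> \<Longrightarrow> \<not> bad (n + 2) \<Omega> A q y u" by blast
  show thesis
  proof (rule that[of "n + 2"])
    fix \<Omega> z x \<xi> s v
    assume *: "\<Omega> \<in> \<K>" "z \<in> \<Omega>" "norm z \<le> R" "norm x \<le> M" "ball x r \<subseteq> \<Omega>" "\<xi> \<notin> \<Omega>" "dist z \<xi> \<le> s"
      "0 < s" "real (n + 2) * s \<le> 1" "complex_disc (z + s *\<^sub>R (x - z)) v \<subseteq> \<Omega>"
    show "complex_disc (z + (real (n + 2) * s) *\<^sub>R (x - z)) (2 *\<^sub>R v) \<subseteq> \<Omega>"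
    proof (rule ccontr)
      assume neg: "\<not> ?thesis"
      have "\<Omega> \<in> C_properly_convex_domains" using * K by blast
      then show False
      proof (rule failed_doubling_rescaling[OF _ *(2,3,4,5) \<open>r > 0\<close> *(6,7,8) _ *(9,10) neg])
        show "1 \<le> real (n + 2)" by simp
      qed (use good[OF *(1)] in \<open>unfold bad_def L_def, blast\<close>)
    qed
  qed simp
qed

section \<open>The boundary estimate\<close>

text \<open>A segment from \<open>z\<close> to a point of the disc outside \<open>\<Omega>\<close>
  would meet the frontier on the same complex line, closer to \<open>z\<close> than the directional
  distance.\<close>

lemma complex_disc_directional_boundary_dist:
  fixes \<Omega> :: "(complex ^ 'd) set"
  assumes "z \<in> \<Omega>" "v \<noteq> 0"
  shows "complex_disc z ((directional_boundary_dist \<Omega> z v / norm v) *\<^sub>R v) \<subseteq> \<Omega>"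
  unfolding complex_disc_subset_iff
proof (intro allI impI, rule ccontr)
  define \<rho> where "\<rho> = directional_boundary_dist \<Omega> z v"
  fix c :: complex
  define b where "b = c *s ((\<rho> / norm v) *\<^sub>R v)"
  assume c: "norm c < 1" and "z + c *s ((directional_boundary_dist \<Omega> z v / norm v) *\<^sub>R v) \<notin> \<Omega>"
  then have "z + b \<notin> \<Omega>" by (simp add: b_def \<rho>_def)
  then have "b \<noteq> 0" using assms(1) by auto
  then have "\<rho> \<noteq> 0" by (auto simp: b_def)
  obtain w where w: "w \<in> closed_segment z (z + b)" "w \<in> frontier \<Omega>"
    using connected_Int_frontier[of "closed_segment z (z + b)" \<Omega>] assms(1) \<open>z + b \<notin> \<Omega>\<close> by auto
  then obtain t where t: "0 \<le> t" "t \<le> 1" "w = z + t *\<^sub>R b"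
    by (auto simp: in_segment algebra_simps)
  have "w = z + (of_real (t * (\<rho> / norm v)) * c) *s v"
    by (simp add: t(3) b_def scaleR_eq_smult vector_smult_assoc mult_ac)
  then have "w \<in> complex_line z v" by (auto simp: complex_line_def)
  then have "\<rho> \<le> norm (z - w)"
    unfolding \<rho>_def directional_boundary_dist_def using w(2)
    by (intro cINF_lower bdd_belowI2[of _ 0]) auto
  also have "\<dots> = t * (norm c * \<bar>\<rho>\<bar>)"
    using t assms(2) by (simp add: b_def norm_smult)
  also have "\<dots> \<le> norm c * \<bar>\<rho>\<bar>"
    using t by (simp add: mult_left_le_one_le)
  finally have "\<rho> \<le> norm c * \<bar>\<rho>\<bar>" .
  \<comment> \<open>The frontier point \<open>w\<close> makes the set under the infimum non-empty,
    so that the real infimum inherits the lower bound 0.\<close>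
  moreover have "0 \<le> \<rho>"
    unfolding \<rho>_def directional_boundary_dist_def using w(2) \<open>w \<in> complex_line z v\<close>
    by (intro cINF_greatest) auto
  ultimately show False
    using c \<open>\<rho> \<noteq> 0\<close> by (simp add: mult_le_cancel_right1)
qed

text \<open>A domain without complex lines is not the whole space, so its frontier is non-empty and
  closed and the infimum is attained. The nearest point lies outside the open set
  \<open>\<Omega>\<close>, hence at positive distance from \<open>z\<close>.\<close>

lemma boundary_dist_attained:
  fixes \<Omega> :: "(complex ^ 'd) set"
  assumes "\<Omega> \<in> C_properly_convex_domains" "z \<in> \<Omega>"
  obtains \<xi> where "\<xi> \<notin> \<Omega>" "boundary_dist \<Omega> z = dist z \<xi>" "boundary_dist \<Omega> z > 0"
proof -
  have "open \<Omega>" and no_line: "\<not> complex_line 0 (axis undefined 1) \<subseteq> \<Omega>"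
    using assms(1) by (auto simp: C_properly_convex_domains_def axis_eq_0_iff)
  then have "frontier \<Omega> \<noteq> {}"
    using assms(2) frontier_eq_empty[of \<Omega>] by auto
  then have eq: "boundary_dist \<Omega> z = infdist z (frontier \<Omega>)"
    by (simp add: boundary_dist_def infdist_def dist_norm)
  obtain \<xi> where "\<xi> \<in> frontier \<Omega>" "infdist z (frontier \<Omega>) = dist z \<xi>"
    using infdist_attains_inf[OF frontier_closed \<open>frontier \<Omega> \<noteq> {}\<close>] by blast
  moreover from this have "\<xi> \<notin> \<Omega>"
    using \<open>open \<Omega>\<close> by (simp add: frontier_def interior_open)
  ultimately show thesis using that eq assms(2) by auto
qed

theorem theorem6p1:
  fixes \<K> :: "(complex ^ 'd) set set"
  assumes "compactin local_Hausdorff_topology \<K>"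
    and "\<forall>D\<in>affine_orbit_closure \<K>. simple_boundary D"
  shows "\<forall>R>0. \<exists>C>0. \<exists>m\<ge>1. \<forall>\<Omega>\<in>\<K>. \<forall>z\<in>\<Omega>. norm z < R \<longrightarrow>
           (\<forall>v. v \<noteq> 0 \<longrightarrow>
              directional_boundary_dist \<Omega> z v \<le> C * boundary_dist \<Omega> z powr (1 / m))"
proof (intro allI impI)
  fix R :: real assume "R > 0"
  have KX: "\<K> \<subseteq> C_properly_convex_domains"
    using compactin_subset_topspace[OF assms(1)] by (simp add: topspace_local_Hausdorff_topology)
  obtain M r where r: "r > 0" "\<And>\<Omega>. \<Omega> \<in> \<K> \<Longrightarrow> \<exists>x. norm x \<le> M \<and> ball x r \<subseteq> \<Omega>"
    by (rule compactin_uniform_inner_ball[OF assms(1)]) (rule that)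
  obtain N :: nat where N: "N \<ge> 2" and double:
    "\<And>\<Omega> z x \<xi> s v. \<Omega> \<in> \<K> \<Longrightarrow> z \<in> \<Omega> \<Longrightarrow> norm z \<le> R \<Longrightarrow> norm x \<le> M \<Longrightarrow> ball x r \<subseteq> \<Omega> \<Longrightarrow>
       \<xi> \<notin> \<Omega> \<Longrightarrow> dist z \<xi> \<le> s \<Longrightarrow> 0 < s \<Longrightarrow> real N * s \<le> 1 \<Longrightarrow>
       complex_disc (z + s *\<^sub>R (x - z)) v \<subseteq> \<Omega> \<Longrightarrow>
       complex_disc (z + (real N * s) *\<^sub>R (x - z)) (2 *\<^sub>R v) \<subseteq> \<Omega>"
    by (rule complex_disc_doubling[OF KX assms(2) r(1)]) (rule that)
  obtain C where C: "C > 0"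
    "\<And>\<Omega> z v. \<Omega> \<in> \<K> \<Longrightarrow> norm z \<le> max R M \<Longrightarrow> complex_disc z v \<subseteq> \<Omega> \<Longrightarrow> norm v \<le> C"
    by (rule compactin_complex_disc_bounded[OF assms(1), of "max R M"]) (rule that)
  \<comment> \<open>The exponent is chosen so that \<open>N powr (1 / m) = 2\<close>.\<close>
  define m where "m = log 2 (real N)"
  have "m \<ge> 1" using N by (simp add: m_def le_log_iff)
  have Nm: "real N powr (1 / m) = 2"
    using N by (simp add: m_def powr_def log_def)
  show "\<exists>C>0. \<exists>m\<ge>1. \<forall>\<Omega>\<in>\<K>. \<forall>z\<in>\<Omega>. norm z < R \<longrightarrow> (\<forall>v. v \<noteq> 0 \<longrightarrow>
      directional_boundary_dist \<Omega> z v \<le> C * boundary_dist \<Omega> z powr (1 / m))"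
  proof (intro exI conjI ballI allI impI)
    \<comment> \<open>One factor 2 pays for halving the initial disc, the other for stopping one
      step before \<open>N ^ j * \<delta>\<close> exceeds 1.\<close>
    show "4 * C > 0" using C by simp
    show "m \<ge> 1" by fact
    fix \<Omega> z and v :: "complex ^ 'd" assume \<Omega>: "\<Omega> \<in> \<K>" "z \<in> \<Omega>" "norm z < R" and "v \<noteq> 0"
    have "\<Omega> \<in> C_properly_convex_domains" using \<Omega> KX by blast
    then have "convex \<Omega>" by (simp add: C_properly_convex_domains_def)
    define \<rho> where "\<rho> = directional_boundary_dist \<Omega> z v"
    define \<delta> where "\<delta> = boundary_dist \<Omega> z"
    obtain \<xi> where \<xi>: "\<xi> \<notin> \<Omega>" "\<delta> = dist z \<xi>" "\<delta> > 0"
      using boundary_dist_attained[OF \<open>\<Omega> \<in> C_properly_convex_domains\<close> \<Omega>(2)] by (metis \<delta>_def)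
    define w where "w = (\<rho> / norm v) *\<^sub>R v"
    have w: "complex_disc z w \<subseteq> \<Omega>" "norm w = \<bar>\<rho>\<bar>"
      using complex_disc_directional_boundary_dist[OF \<Omega>(2) \<open>v \<noteq> 0\<close>] \<open>v \<noteq> 0\<close>
      by (auto simp: w_def \<rho>_def)
    have "\<rho> \<le> 4 * C * \<delta> powr (1 / m)"
    proof (cases "\<delta> \<ge> 1/2")
      case True
      \<comment> \<open>Away from the boundary the power of \<open>\<delta>\<close> is bounded
        below, so the uniform bound on discs suffices.\<close>
      have "norm w \<le> C" using \<Omega>(3) by (intro C(2)[OF \<Omega>(1) _ w(1)]) simp
      then have "\<rho> \<le> C" using w(2) by simp
      moreover have "(1/4 :: real) \<le> (1/2) powr (1 / m)"
      proof -
        have "(1/2 :: real) powr 1 \<le> (1/2) powr (1 / m)"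
          using \<open>m \<ge> 1\<close> by (intro powr_mono') auto
        then show ?thesis by simp
      qed
      moreover have "(1/2) powr (1 / m) \<le> \<delta> powr (1 / m)"
        using True \<open>m \<ge> 1\<close> by (intro powr_mono2) auto
      ultimately have "1 \<le> 4 * \<delta> powr (1 / m)" by linarith
      then have "C * 1 \<le> C * (4 * \<delta> powr (1 / m))" using C(1) by (intro mult_left_mono) auto
      then show ?thesis using \<open>\<rho> \<le> C\<close> by (simp add: mult_ac)
    next
      case False
      obtain x where x: "norm x \<le> M" "ball x r \<subseteq> \<Omega>" using r(2) \<Omega>(1) by blast
      then have "x \<in> \<Omega>" using r(1) by (metis centre_in_ball subsetD)
      define P where "P s = z + s *\<^sub>R (x - z)" for s
      \<comment> \<open>Convex combinations of the disc at \<open>z\<close> with the point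
        \<open>x\<close> form a disc at \<open>P \<delta>\<close> with direction shrunk by
        \<open>1 - \<delta>\<close>. As this factor exceeds one half, the disc can be cut to exactly
        half size.\<close>
      have "complex_disc (P \<delta>) ((1 - \<delta>) *\<^sub>R w) \<subseteq> \<Omega>"
        unfolding complex_disc_subset_iff
      proof (intro allI impI)
        fix c :: complex assume "norm c < 1"
        then have mem: "(1 - \<delta>) *\<^sub>R (z + c *s w) + \<delta> *\<^sub>R x \<in> \<Omega>"
          using w(1) \<open>x \<in> \<Omega>\<close> \<xi>(3) False
          by (intro convexD[OF \<open>convex \<Omega>\<close>]) (auto simp: complex_disc_subset_iff)
        have "(1 - \<delta>) *\<^sub>R (c *s w) = c *s ((1 - \<delta>) *\<^sub>R w)"
          by (simp only: scaleR_eq_smult vector_smult_assoc mult.commute)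
        moreover have "P \<delta> = (1 - \<delta>) *\<^sub>R z + \<delta> *\<^sub>R x"
          by (simp add: P_def algebra_simps)
        ultimately have "(1 - \<delta>) *\<^sub>R (z + c *s w) + \<delta> *\<^sub>R x = P \<delta> + c *s ((1 - \<delta>) *\<^sub>R w)"
          by (simp only: scaleR_add_right add_ac)
        then show "P \<delta> + c *s ((1 - \<delta>) *\<^sub>R w) \<in> \<Omega>" using mem by simp
      qed
      moreover have "\<bar>1 / (2 * (1 - \<delta>))\<bar> \<le> 1" using False by simp
      ultimately have "complex_disc (P \<delta>) ((1 / (2 * (1 - \<delta>))) *\<^sub>R (1 - \<delta>) *\<^sub>R w) \<subseteq> \<Omega>"
        by (rule complex_disc_scaleR_subset)
      moreover have "1 / (2 * (1 - \<delta>)) * (1 - \<delta>) = 1 / 2" using False by (simp add: divide_simps)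
      ultimately have start: "complex_disc (P \<delta>) ((1/2) *\<^sub>R w) \<subseteq> \<Omega>"
        by (simp only: scaleR_scaleR)
      \<comment> \<open>Each step multiplies the parameter by \<open>N\<close> and the disc by 2.
        Doubling applies at every stage because the parameter stays at least
        \<open>\<delta>\<close>, the distance from \<open>z\<close> to \<open>\<xi>\<close>.\<close>
      have iter: "complex_disc (P (real N ^ k * \<delta>)) ((2 ^ k / 2) *\<^sub>R w) \<subseteq> \<Omega>"
        if "real N ^ k * \<delta> \<le> 1" for k
        using that
      proof (induction k)
        case 0
        then show ?case using start by simp
      next
        case (Suc k)
        have N1: "1 \<le> real N ^ k" using N by simp
        have pos: "0 < real N ^ k * \<delta>" using N \<xi>(3) by (intro mult_pos_pos zero_less_power) auto
        have le: "real N * (real N ^ k * \<delta>) \<le> 1" using Suc.prems by (simp add: mult_ac)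
        moreover have "real N ^ k * \<delta> \<le> real N * (real N ^ k * \<delta>)"
          using N mult_right_mono[OF _ less_imp_le[OF pos], of 1 "real N"] by simp
        ultimately have "real N ^ k * \<delta> \<le> 1" by linarith
        then have IH: "complex_disc (z + (real N ^ k * \<delta>) *\<^sub>R (x - z)) ((2 ^ k / 2) *\<^sub>R w) \<subseteq> \<Omega>"
          using Suc.IH by (simp add: P_def)
        have "dist z \<xi> \<le> real N ^ k * \<delta>"
          using N1 \<xi>(2,3) mult_right_mono[OF N1, of \<delta>] by simp
        then have "complex_disc (z + (real N * (real N ^ k * \<delta>)) *\<^sub>R (x - z)) (2 *\<^sub>R (2 ^ k / 2) *\<^sub>R w) \<subseteq> \<Omega>"
          using double[OF \<Omega>(1,2) _ x \<xi>(1) _ pos le IH] \<Omega>(3) by simp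
        then show ?case by (simp add: P_def mult_ac)
      qed
      obtain n where "real N ^ n > 1 / \<delta>"
        using real_arch_pow[of "real N" "1 / \<delta>"] N by auto
      then have ex: "real N ^ n * \<delta> > 1" using \<xi>(3) by (simp add: field_simps)
      \<comment> \<open>The first exponent at which the parameter exceeds 1. It is positive because
        \<open>\<delta> < 1/2\<close>, and its predecessor \<open>k\<close> is the last stage of the
        iteration.\<close>
      define j where "j = (LEAST n. real N ^ n * \<delta> > 1)"
      have j: "real N ^ j * \<delta> > 1" unfolding j_def using ex by (rule LeastI)
      have "j \<noteq> 0" using j False by (cases j) auto
      then obtain k where k: "j = Suc k" by (cases j) auto
      have small: "real N ^ k * \<delta> \<le> 1"
        using not_less_Least[of k "\<lambda>n. real N ^ n * \<delta> > 1"] k by (simp add: j_def not_less)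
      \<comment> \<open>Points between \<open>z\<close> and \<open>x\<close> stay in a fixed ball,
        so the constant \<open>C\<close> applies to the final disc.\<close>
      have "norm (P t) \<le> max R M" if "0 \<le> t" "t \<le> 1" for t
      proof -
        have "P t = (1 - t) *\<^sub>R z + t *\<^sub>R x" by (simp add: P_def algebra_simps)
        also have "\<dots> \<in> cball 0 (max R M)"
          using that \<Omega>(3) x(1) by (intro convexD[OF convex_cball]) auto
        finally show ?thesis by simp
      qed
      then have "norm ((2 ^ k / 2) *\<^sub>R w) \<le> C"
        using iter[OF small] small \<xi>(3) by (intro C(2)[OF \<Omega>(1)]) auto
      then have "2 ^ k * \<bar>\<rho>\<bar> \<le> 2 * C" using w(2) by simp
      moreover have "(2::real) ^ k * \<rho> \<le> 2 ^ k * \<bar>\<rho>\<bar>" by (intro mult_left_mono) auto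
      ultimately have "2 ^ k * \<rho> \<le> 2 * C" by linarith
      then have "2 ^ j * \<rho> \<le> 4 * C" by (simp add: k mult_ac)
      \<comment> \<open>Raising \<open>N ^ j * \<delta> > 1\<close> to the power
        \<open>1 / m\<close> turns \<open>N ^ j\<close> into \<open>2 ^ j\<close>, which exchanges
        the gain in disc size for the power of \<open>\<delta>\<close>.\<close>
      moreover have "1 \<le> 2 ^ j * \<delta> powr (1 / m)"
      proof -
        have "1 \<le> (real N ^ j * \<delta>) powr (1 / m)"
          using j \<open>m \<ge> 1\<close> by (intro ge_one_powr_ge_zero) auto
        also have "\<dots> = (real N ^ j) powr (1 / m) * \<delta> powr (1 / m)"
          using \<xi>(3) by (simp add: powr_mult)
        also have "(real N ^ j) powr (1 / m) = (real N powr (1 / m)) ^ j"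
          using N by (simp add: powr_realpow[symmetric] powr_powr powr_power mult.commute)
        finally show ?thesis by (simp add: Nm)
      qed
      then have "4 * C * 1 \<le> 4 * C * (2 ^ j * \<delta> powr (1 / m))"
        using C(1) by (intro mult_left_mono) auto
      ultimately have "2 ^ j * \<rho> \<le> 4 * C * (2 ^ j * \<delta> powr (1 / m))" by linarith
      then have "2 ^ j * \<rho> \<le> 2 ^ j * (4 * C * \<delta> powr (1 / m))" by (simp add: mult_ac)
      then show ?thesis by simp
    qed
    then show "directional_boundary_dist \<Omega> z v \<le> 4 * C * boundary_dist \<Omega> z powr (1 / m)"
      by (simp add: \<rho>_def \<delta>_def)
  qed
qed

end
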